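(* Let $(M,g)$ be a smooth Riemannian manifold of dimension $n>1$, and let $J$ be the natural almost complex structure of diagonal type on $T^*M$ determined by smooth functions $a_1,a_2,b_1,b_2:[0,\infty)\to\mathbb{R}$ with $a_1a_2=1$, $(a_1+2tb_1)(a_2+2tb_2)=1$ and $a_1,\ a_2,\ a_1+2tb_1,\ a_2+2tb_2>0$ for all $t\ge0$. Let $G$ be the natural Riemannian metric of diagonal type on $T^*M$ determined by smooth functions $c_1,c_2,d_1,d_2:[0,\infty)\to\mathbb{R}$ with $c_1,\ c_2,\ c_1+2td_1,\ c_2+2td_2>0$. Then $(T^*M,G,J)$ is an almost Hermitian manifold if and only if there exist smooth functions $\lambda,\mu:[0,\infty)\to\mathbb{R}$ with $\lambda>0$ and $\lambda+2t\mu>0$ such that $$c_1=\lambda a_1,\qquad c_2=\lambda a_2,$$ $$c_1+2td_1=(\lambda+2t\mu)(a_1+2tb_1),\qquad c_2+2td_2=(\lambda+2t\mu)(a_2+2tb_2).$$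
   Context: Let $(M,g)$ be an $n$-dimensional Riemannian manifold and $\pi:T^*M\to M$ its cotangent bundle. A local chart $(U,x^1,\dots,x^n)$ of $M$ induces a chart $(\pi^{-1}(U),q^1,\dots,q^n,p_1,\dots,p_n)$ of $T^*M$ with $q^i=x^i\circ\pi$ and $p=p_i\,dx^i_{\pi(p)}$. Summation convention is used. Let $\Gamma^k_{ij}$ be the Christoffel symbols of the Levi-Civita connection of $g$, $(g^{ij})$ the inverse matrix of $(g_{ij})$, $\Gamma^0_{ih}=p_k\Gamma^k_{ih}$, $g^{0i}=p_hg^{hi}$, $\partial^i=\partial/\partial p_i$ and $\delta_i=\partial/\partial q^i+\Gamma^0_{ih}\,\partial/\partial p_h$. Then $(\partial^1,\dots,\partial^n,\delta_1,\dots,\delta_n)$ is a local frame on $T^*M$. Let $t=\frac12 g^{ik}p_ip_k\in[0,\infty)$ be the energy density; functions of $t$ are regarded as functions on $T^*M$. The natural almost complex structure of diagonal type determined by $a_1,a_2,b_1,b_2$ is $$J\delta_i=a_1g_{ij}\partial^j+b_1p_ip_j\partial^j,\qquad J\partial^i=-a_2g^{ij}\delta_j-b_2g^{0i}g^{0j}\delta_j.$$ The natural Riemannian metric of diagonal type determined by $c_1,c_2,d_1,d_2$ is given by $$G(\delta_i,\delta_j)=c_1g_{ij}+d_1p_ip_j,\qquad G(\partial^i,\partial^j)=c_2g^{ij}+d_2g^{0i}g^{0j},\qquad G(\partial^i,\delta_j)=0.$$ $(T^*M,G,J)$ is almost Hermitian if $G(JX,JY)=G(X,Y)$ for all vector fields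 $X,Y$ on $T^*M$. All objects are smooth. *)

theory Defs
  imports "HOL-Analysis.Analysis" "HOL-Library.Function_Algebras"
begin

section \<open>Smooth functions\<close>

text \<open>
  Iterated directional derivatives relative to a set \<open>S\<close>. The sets used below are open sets
  and the half-line \<open>{0..}\<close>; there derivatives within \<open>S\<close> are unique, and on \<open>{0..}\<close> they are
  one-sided at the end point.
\<close>

primrec iter_deriv ::
  "'a::real_normed_vector set \<Rightarrow> 'a list \<Rightarrow> ('a \<Rightarrow> 'b::real_normed_vector) \<Rightarrow> 'a \<Rightarrow> 'b" where
  "iter_deriv S [] f = f"
| "iter_deriv S (v # vs) f =
     (\<lambda>x. frechet_derivative (iter_deriv S vs f) (at x within S) v)"

definition smooth_on ::
  "'a::real_normed_vector set \<Rightarrow> ('a \<Rightarrow> 'b::real_normed_vector) \<Rightarrow> bool" where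
  "smooth_on S f \<longleftrightarrow> (\<forall>vs. iter_deriv S vs f differentiable_on S)"


section \<open>Pointwise real vector space structure on functions\<close>

instantiation "fun" :: (type, real_vector) real_vector
begin

definition "scaleR_fun r f = (\<lambda>x. r *\<^sub>R f x)"

instance
  by standard (auto simp: scaleR_fun_def fun_eq_iff algebra_simps)

end


section \<open>Atlases, tangent vectors, vector fields\<close>

text \<open>A chart is a pair of its domain and its coordinate map, of which only the values on the
  domain matter.\<close>

type_synonym ('m, 'e) chart = "'m set \<times> ('m \<Rightarrow> 'e)"

abbreviation chart_inv :: "('m, 'e) chart \<Rightarrow> 'e \<Rightarrow> 'm" where
  "chart_inv c \<equiv> inv_into (fst c) (snd c)"

definition smooth_atlas ::
  "('m::{t2_space, second_countable_topology}, 'e::euclidean_space) chart set \<Rightarrow> bool" where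
  "smooth_atlas A \<longleftrightarrow>
     (\<Union>c\<in>A. fst c) = UNIV \<and>
     (\<forall>c\<in>A. open (fst c) \<and> open (snd c ` fst c) \<and>
        homeomorphism (fst c) (snd c ` fst c) (snd c) (chart_inv c)) \<and>
     (\<forall>c\<in>A. \<forall>d\<in>A. smooth_on (snd c ` (fst c \<inter> fst d)) (snd d \<circ> chart_inv c))"

text \<open>
  A tangent vector at \<open>x\<close> is the family of its components in all charts around \<open>x\<close>; components in
  different charts are related by the Jacobian of the transition map. To make the family unique,
  it is zero on all other charts. \<open>coord_vec A c x u\<close> is the tangent vector at \<open>x\<close> whose component
  vector in the chart \<open>c\<close> is \<open>u\<close>.
\<close>

type_synonym ('m, 'e) tvec = "('m, 'e) chart \<Rightarrow> 'e"

definition coord_vec ::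
  "('m, 'e::euclidean_space) chart set \<Rightarrow> ('m, 'e) chart \<Rightarrow> 'm \<Rightarrow> 'e \<Rightarrow> ('m, 'e) tvec" where
  "coord_vec A c x u =
     (\<lambda>d. if d \<in> A \<and> x \<in> fst d then frechet_derivative (snd d \<circ> chart_inv c) (at (snd c x)) u
          else 0)"

definition tangent_space ::
  "('m, 'e::euclidean_space) chart set \<Rightarrow> 'm \<Rightarrow> ('m, 'e) tvec set" where
  "tangent_space A x =
     {v. (\<forall>c. c \<notin> A \<or> x \<notin> fst c \<longrightarrow> v c = 0) \<and>
         (\<forall>c\<in>A. x \<in> fst c \<longrightarrow> v = coord_vec A c x (v c))}"

definition smooth_vector_field ::
  "('m, 'e::euclidean_space) chart set \<Rightarrow> ('m \<Rightarrow> ('m, 'e) tvec) \<Rightarrow> bool" where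
  "smooth_vector_field A X \<longleftrightarrow>
     (\<forall>x \<in> (\<Union>c\<in>A. fst c). X x \<in> tangent_space A x) \<and>
     (\<forall>c\<in>A. smooth_on (snd c ` fst c) (\<lambda>q. X (chart_inv c q) c))"


section \<open>Riemannian metrics and Christoffel symbols\<close>

definition metric_matrix ::
  "('m, real^'n) chart set \<Rightarrow> ('m \<Rightarrow> ('m, real^'n) tvec \<Rightarrow> ('m, real^'n) tvec \<Rightarrow> real)
     \<Rightarrow> ('m, real^'n) chart \<Rightarrow> 'm \<Rightarrow> real^'n^'n" where
  "metric_matrix A g c x =
     (\<chi> i j. g x (coord_vec A c x (axis i 1)) (coord_vec A c x (axis j 1)))"

definition riemannian_metric ::
  "('m, real^'n) chart set \<Rightarrow> ('m \<Rightarrow> ('m, real^'n) tvec \<Rightarrow> ('m, real^'n) tvec \<Rightarrow> real) \<Rightarrow> bool"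
  where
  "riemannian_metric A g \<longleftrightarrow>
     (\<forall>x \<in> (\<Union>c\<in>A. fst c).
        (\<forall>u\<in>tangent_space A x. \<forall>v\<in>tangent_space A x. \<forall>w\<in>tangent_space A x. \<forall>r.
           g x (r *\<^sub>R u + v) w = r * g x u w + g x v w) \<and>
        (\<forall>u\<in>tangent_space A x. \<forall>v\<in>tangent_space A x. g x u v = g x v u) \<and>
        (\<forall>v\<in>tangent_space A x. v \<noteq> 0 \<longrightarrow> g x v v > 0)) \<and>
     (\<forall>c\<in>A. smooth_on (snd c ` fst c) (\<lambda>q. metric_matrix A g c (chart_inv c q)))"

definition metric_deriv ::
  "('m, real^'n) chart set \<Rightarrow> ('m \<Rightarrow> ('m, real^'n) tvec \<Rightarrow> ('m, real^'n) tvec \<Rightarrow> real)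
     \<Rightarrow> ('m, real^'n) chart \<Rightarrow> 'm \<Rightarrow> 'n \<Rightarrow> 'n \<Rightarrow> 'n \<Rightarrow> real" where
  "metric_deriv A g c x k i j =
     frechet_derivative (\<lambda>q. metric_matrix A g c (chart_inv c q) $ i $ j) (at (snd c x)) (axis k 1)"

text \<open>\<open>christoffel A g c x k i j\<close> is \<open>\<Gamma>\<^sup>k\<close> with lower indices \<open>i\<close>, \<open>j\<close>, at \<open>x\<close> in the chart \<open>c\<close>.\<close>

definition christoffel ::
  "('m, real^'n) chart set \<Rightarrow> ('m \<Rightarrow> ('m, real^'n) tvec \<Rightarrow> ('m, real^'n) tvec \<Rightarrow> real)
     \<Rightarrow> ('m, real^'n) chart \<Rightarrow> 'm \<Rightarrow> 'n \<Rightarrow> 'n \<Rightarrow> 'n \<Rightarrow> real" where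
  "christoffel A g c x k i j =
     (1/2) * (\<Sum>l\<in>UNIV. matrix_inv (metric_matrix A g c x) $ k $ l *
        (metric_deriv A g c x i j l + metric_deriv A g c x j i l - metric_deriv A g c x l i j))"

text \<open>
  These are the coefficients of the Levi-Civita connection: they are the only coefficients of a
  torsion-free connection (symmetry in the lower indices) that is compatible with the metric.
\<close>

lemma christoffel_levi_civita:
  fixes A :: "('m, real^'n) chart set" and \<Gamma> :: "'n \<Rightarrow> 'n \<Rightarrow> 'n \<Rightarrow> real"
  assumes inv: "invertible (metric_matrix A g c x)"
    and sym: "\<And>i j. metric_matrix A g c x $ i $ j = metric_matrix A g c x $ j $ i"
    and dsym: "\<And>k i j. metric_deriv A g c x k i j = metric_deriv A g c x k j i"
  shows "(\<forall>k i j. \<Gamma> k i j = \<Gamma> k j i) \<and>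
         (\<forall>k i j. metric_deriv A g c x k i j =
            (\<Sum>l\<in>UNIV. \<Gamma> l k i * metric_matrix A g c x $ l $ j
                   + \<Gamma> l k j * metric_matrix A g c x $ i $ l))
         \<longleftrightarrow> \<Gamma> = christoffel A g c x"
proof -
  let ?G = "metric_matrix A g c x"
  let ?H = "matrix_inv ?G"
  let ?D = "metric_deriv A g c x"
  define F where "F = (\<lambda>\<Gamma> i j m. \<Sum>l\<in>UNIV. ?G $ m $ l * (\<Gamma> :: 'n \<Rightarrow> 'n \<Rightarrow> 'n \<Rightarrow> real) l i j)"
  have "?G ** ?H = mat 1 \<and> ?H ** ?G = mat 1"
    unfolding matrix_inv_def by (rule someI_ex) (use inv in \<open>simp add: invertible_def\<close>)
  then have GH: "(\<Sum>l\<in>UNIV. ?G $ a $ l * ?H $ l $ b) = (if a = b then 1 else 0)"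
    and HG: "(\<Sum>l\<in>UNIV. ?H $ a $ l * ?G $ l $ b) = (if a = b then 1 else 0)" for a b
    by (auto simp: matrix_matrix_mult_def mat_def vec_eq_iff)
  have Fch: "F (christoffel A g c x) i j m = (?D i j m + ?D j i m - ?D m i j) / 2" for i j m
  proof -
    have "F (christoffel A g c x) i j m =
        (\<Sum>l\<in>UNIV. \<Sum>s\<in>UNIV. ?G $ m $ l * ?H $ l $ s * ((?D i j s + ?D j i s - ?D s i j) / 2))"
      by (simp add: F_def christoffel_def sum_distrib_left mult_ac)
    also have "\<dots> = (\<Sum>s\<in>UNIV. (\<Sum>l\<in>UNIV. ?G $ m $ l * ?H $ l $ s) * ((?D i j s + ?D j i s - ?D s i j) / 2))"
      by (subst sum.swap) (simp only: sum_distrib_right)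
    finally show ?thesis
      by (simp add: GH if_distrib if_distribR cong: if_cong)
  qed
  have inj: "\<Gamma> = \<Gamma>'" if "\<And>i j m. F \<Gamma> i j m = F \<Gamma>' i j m" for \<Gamma> \<Gamma>'
  proof (intro ext)
    have rec: "\<Gamma> k i j = (\<Sum>m\<in>UNIV. ?H $ k $ m * F \<Gamma> i j m)" for \<Gamma> k i j
    proof -
      have "(\<Sum>m\<in>UNIV. ?H $ k $ m * F \<Gamma> i j m) = (\<Sum>m\<in>UNIV. \<Sum>l\<in>UNIV. ?H $ k $ m * ?G $ m $ l * \<Gamma> l i j)"
        by (simp add: F_def sum_distrib_left mult_ac)
      also have "\<dots> = (\<Sum>l\<in>UNIV. (\<Sum>m\<in>UNIV. ?H $ k $ m * ?G $ m $ l) * \<Gamma> l i j)"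
        by (subst sum.swap) (simp only: sum_distrib_right)
      finally show ?thesis
        by (simp add: HG if_distrib if_distribR cong: if_cong)
    qed
    show "\<Gamma> k i j = \<Gamma>' k i j" for k i j
      using that by (simp add: rec[of \<Gamma>] rec[of \<Gamma>'])
  qed
  have compat: "(\<Sum>l\<in>UNIV. \<Gamma> l k i * ?G $ l $ j + \<Gamma> l k j * ?G $ i $ l) = F \<Gamma> k i j + F \<Gamma> k j i"
    for \<Gamma> k i j
    by (simp add: F_def sum.distrib sym[of _ j] mult.commute)
  show ?thesis
  proof
    assume L: "(\<forall>k i j. \<Gamma> k i j = \<Gamma> k j i) \<and>
         (\<forall>k i j. ?D k i j = (\<Sum>l\<in>UNIV. \<Gamma> l k i * ?G $ l $ j + \<Gamma> l k j * ?G $ i $ l))"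
    then have D: "?D k i j = F \<Gamma> k i j + F \<Gamma> k j i" for k i j
      by (simp add: compat)
    have S: "F \<Gamma> i j m = F \<Gamma> j i m" for i j m
      unfolding F_def using L by metis
    show "\<Gamma> = christoffel A g c x"
    proof (rule inj)
      fix i j m
      show "F \<Gamma> i j m = F (christoffel A g c x) i j m"
        using S[of i j m] S[of i m j] S[of j m i]
        by (simp add: Fch D)
    qed
  next
    assume R: "\<Gamma> = christoffel A g c x"
    have "\<Gamma> k i j = \<Gamma> k j i" for k i j
      unfolding R christoffel_def using dsym by (simp add: add.commute)
    moreover have "?D k i j = (\<Sum>l\<in>UNIV. \<Gamma> l k i * ?G $ l $ j + \<Gamma> l k j * ?G $ i $ l)" for k i j
      unfolding compat unfolding R Fch using dsym[of k i j] by (simp add: field_simps)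
    ultimately show "(\<forall>k i j. \<Gamma> k i j = \<Gamma> k j i) \<and>
         (\<forall>k i j. ?D k i j = (\<Sum>l\<in>UNIV. \<Gamma> l k i * ?G $ l $ j + \<Gamma> l k j * ?G $ i $ l))"
      by blast
  qed
qed


section \<open>The cotangent bundle\<close>

text \<open>A covector at \<open>x\<close> is a linear functional on the tangent space, made unique as a function by
  being zero elsewhere.\<close>

type_synonym ('m, 'e) covec = "('m, 'e) tvec \<Rightarrow> real"

definition cotangent_space ::
  "('m, 'e::euclidean_space) chart set \<Rightarrow> 'm \<Rightarrow> ('m, 'e) covec set" where
  "cotangent_space A x =
     {\<omega>. (\<forall>v\<in>tangent_space A x. \<forall>w\<in>tangent_space A x. \<forall>r. \<omega> (r *\<^sub>R v + w) = r * \<omega> v + \<omega> w) \<and>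
         (\<forall>v. v \<notin> tangent_space A x \<longrightarrow> \<omega> v = 0)}"

definition cotangent_bundle ::
  "('m, 'e::euclidean_space) chart set \<Rightarrow> ('m \<times> ('m, 'e) covec) set" where
  "cotangent_bundle A = {(x, \<omega>). x \<in> (\<Union>c\<in>A. fst c) \<and> \<omega> \<in> cotangent_space A x}"

definition momentum ::
  "('m, real^'n) chart set \<Rightarrow> ('m, real^'n) chart \<Rightarrow> 'm \<times> ('m, real^'n) covec \<Rightarrow> real^'n" where
  "momentum A c P = (\<chi> i. snd P (coord_vec A c (fst P) (axis i 1)))"

text \<open>The chart \<open>(\<pi>\<^sup>-\<^sup>1(U), q, p)\<close> induced by a chart of the base.\<close>

definition cotangent_chart ::
  "('m, real^'n) chart set \<Rightarrow> ('m, real^'n) chart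
     \<Rightarrow> ('m \<times> ('m, real^'n) covec, (real^'n) \<times> (real^'n)) chart" where
  "cotangent_chart A c =
     ({P \<in> cotangent_bundle A. fst P \<in> fst c}, \<lambda>P. (snd c (fst P), momentum A c P))"

definition cotangent_atlas ::
  "('m, real^'n) chart set \<Rightarrow> ('m \<times> ('m, real^'n) covec, (real^'n) \<times> (real^'n)) chart set" where
  "cotangent_atlas A = cotangent_chart A ` A"

type_synonym ('m, 'n) ctvec = "('m \<times> ('m, real^'n) covec, (real^'n) \<times> (real^'n)) tvec"


section \<open>The adapted frame\<close>

text \<open>\<open>frame_q\<close> is \<open>\<partial>/\<partial>q\<^sup>i\<close>, \<open>frame_p\<close> is \<open>\<partial>\<^sup>i = \<partial>/\<partial>p\<^sub>i\<close> and \<open>frame_delta\<close> is \<open>\<delta>\<^sub>i\<close>,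
  at the point \<open>P\<close> and with respect to the chart induced by \<open>c\<close>.\<close>

definition frame_q ::
  "('m, real^'n) chart set \<Rightarrow> ('m, real^'n) chart \<Rightarrow> 'm \<times> ('m, real^'n) covec \<Rightarrow> 'n
     \<Rightarrow> ('m, 'n) ctvec" where
  "frame_q A c P i = coord_vec (cotangent_atlas A) (cotangent_chart A c) P (axis i 1, 0)"

definition frame_p ::
  "('m, real^'n) chart set \<Rightarrow> ('m, real^'n) chart \<Rightarrow> 'm \<times> ('m, real^'n) covec \<Rightarrow> 'n
     \<Rightarrow> ('m, 'n) ctvec" where
  "frame_p A c P i = coord_vec (cotangent_atlas A) (cotangent_chart A c) P (0, axis i 1)"

definition christoffel0 ::
  "('m, real^'n) chart set \<Rightarrow> ('m \<Rightarrow> ('m, real^'n) tvec \<Rightarrow> ('m, real^'n) tvec \<Rightarrow> real)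
     \<Rightarrow> ('m, real^'n) chart \<Rightarrow> 'm \<times> ('m, real^'n) covec \<Rightarrow> 'n \<Rightarrow> 'n \<Rightarrow> real" where
  "christoffel0 A g c P i h =
     (\<Sum>k\<in>UNIV. momentum A c P $ k * christoffel A g c (fst P) k i h)"

definition frame_delta ::
  "('m, real^'n) chart set \<Rightarrow> ('m \<Rightarrow> ('m, real^'n) tvec \<Rightarrow> ('m, real^'n) tvec \<Rightarrow> real)
     \<Rightarrow> ('m, real^'n) chart \<Rightarrow> 'm \<times> ('m, real^'n) covec \<Rightarrow> 'n \<Rightarrow> ('m, 'n) ctvec" where
  "frame_delta A g c P i =
     frame_q A c P i + (\<Sum>h\<in>UNIV. christoffel0 A g c P i h *\<^sub>R frame_p A c P h)"

definition raised_momentum ::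
  "('m, real^'n) chart set \<Rightarrow> ('m \<Rightarrow> ('m, real^'n) tvec \<Rightarrow> ('m, real^'n) tvec \<Rightarrow> real)
     \<Rightarrow> ('m, real^'n) chart \<Rightarrow> 'm \<times> ('m, real^'n) covec \<Rightarrow> 'n \<Rightarrow> real" where
  "raised_momentum A g c P i =
     (\<Sum>h\<in>UNIV. momentum A c P $ h * matrix_inv (metric_matrix A g c (fst P)) $ h $ i)"

definition energy ::
  "('m, real^'n) chart set \<Rightarrow> ('m \<Rightarrow> ('m, real^'n) tvec \<Rightarrow> ('m, real^'n) tvec \<Rightarrow> real)
     \<Rightarrow> ('m, real^'n) chart \<Rightarrow> 'm \<times> ('m, real^'n) covec \<Rightarrow> real" where
  "energy A g c P =
     (1/2) * (\<Sum>i\<in>UNIV. \<Sum>k\<in>UNIV. matrix_inv (metric_matrix A g c (fst P)) $ i $ k *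
        momentum A c P $ i * momentum A c P $ k)"


section \<open>Natural structures of diagonal type\<close>

definition natural_almost_complex ::
  "('m, real^'n) chart set \<Rightarrow> ('m \<Rightarrow> ('m, real^'n) tvec \<Rightarrow> ('m, real^'n) tvec \<Rightarrow> real)
     \<Rightarrow> (real \<Rightarrow> real) \<Rightarrow> (real \<Rightarrow> real) \<Rightarrow> (real \<Rightarrow> real) \<Rightarrow> (real \<Rightarrow> real)
     \<Rightarrow> ('m \<times> ('m, real^'n) covec \<Rightarrow> ('m, 'n) ctvec \<Rightarrow> ('m, 'n) ctvec) \<Rightarrow> bool" where
  "natural_almost_complex A g a1 a2 b1 b2 J \<longleftrightarrow>
     (\<forall>P\<in>cotangent_bundle A.
        let T = tangent_space (cotangent_atlas A) P in
          (\<forall>v\<in>T. J P v \<in> T) \<and>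
          (\<forall>v\<in>T. \<forall>w\<in>T. \<forall>r. J P (r *\<^sub>R v + w) = r *\<^sub>R J P v + J P w)) \<and>
     (\<forall>c\<in>A. \<forall>P\<in>cotangent_bundle A. fst P \<in> fst c \<longrightarrow>
        (let gl = metric_matrix A g c (fst P);
             gu = matrix_inv (metric_matrix A g c (fst P));
             p = momentum A c P;
             g0 = raised_momentum A g c P;
             t = energy A g c P
         in \<forall>i. J P (frame_delta A g c P i) =
                  (\<Sum>j\<in>UNIV. (a1 t * gl $ i $ j + b1 t * p $ i * p $ j) *\<^sub>R frame_p A c P j) \<and>
                J P (frame_p A c P i) =
                  - (\<Sum>j\<in>UNIV. (a2 t * gu $ i $ j + b2 t * g0 i * g0 j) *\<^sub>R frame_delta A g c P j)))"

definition natural_metric ::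
  "('m, real^'n) chart set \<Rightarrow> ('m \<Rightarrow> ('m, real^'n) tvec \<Rightarrow> ('m, real^'n) tvec \<Rightarrow> real)
     \<Rightarrow> (real \<Rightarrow> real) \<Rightarrow> (real \<Rightarrow> real) \<Rightarrow> (real \<Rightarrow> real) \<Rightarrow> (real \<Rightarrow> real)
     \<Rightarrow> ('m \<times> ('m, real^'n) covec \<Rightarrow> ('m, 'n) ctvec \<Rightarrow> ('m, 'n) ctvec \<Rightarrow> real) \<Rightarrow> bool" where
  "natural_metric A g c1 c2 d1 d2 G \<longleftrightarrow>
     (\<forall>P\<in>cotangent_bundle A.
        let T = tangent_space (cotangent_atlas A) P in
          (\<forall>u\<in>T. \<forall>v\<in>T. \<forall>w\<in>T. \<forall>r. G P (r *\<^sub>R u + v) w = r * G P u w + G P v w) \<and>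
          (\<forall>v\<in>T. \<forall>w\<in>T. G P v w = G P w v)) \<and>
     (\<forall>c\<in>A. \<forall>P\<in>cotangent_bundle A. fst P \<in> fst c \<longrightarrow>
        (let gl = metric_matrix A g c (fst P);
             gu = matrix_inv (metric_matrix A g c (fst P));
             p = momentum A c P;
             g0 = raised_momentum A g c P;
             t = energy A g c P
         in \<forall>i j.
              G P (frame_delta A g c P i) (frame_delta A g c P j) =
                c1 t * gl $ i $ j + d1 t * p $ i * p $ j \<and>
              G P (frame_p A c P i) (frame_p A c P j) = c2 t * gu $ i $ j + d2 t * g0 i * g0 j \<and>
              G P (frame_p A c P i) (frame_delta A g c P j) = 0))"

definition almost_hermitian ::
  "('m, 'e::euclidean_space) chart set \<Rightarrow> ('m \<Rightarrow> ('m, 'e) tvec \<Rightarrow> ('m, 'e) tvec \<Rightarrow> real)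
     \<Rightarrow> ('m \<Rightarrow> ('m, 'e) tvec \<Rightarrow> ('m, 'e) tvec) \<Rightarrow> bool" where
  "almost_hermitian A G J \<longleftrightarrow>
     (\<forall>X Y. smooth_vector_field A X \<longrightarrow> smooth_vector_field A Y \<longrightarrow>
        (\<forall>x \<in> (\<Union>c\<in>A. fst c). G x (J x (X x)) (J x (Y x)) = G x (X x) (Y x)))"

end

theory Submission
  imports Defs
begin

text \<open>
  On a fibre with energy density \<open>t\<close>, \<open>G\<close> and \<open>J\<close> are combinations of \<open>g\<^sub>i\<^sub>j\<close> and \<open>p\<^sub>i p\<^sub>j\<close>
  in the adapted frame. Splitting into the direction of \<open>p\<close> and its orthogonal complement,
  compatibility on vertical vectors says exactly \<open>c\<^sub>2 = a\<^sub>2\<^sup>2 c\<^sub>1\<close> and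
  \<open>c\<^sub>2 + 2td\<^sub>2 = (a\<^sub>2 + 2tb\<^sub>2)\<^sup>2 (c\<^sub>1 + 2td\<^sub>1)\<close>; the complement is nonzero because \<open>n > 1\<close>. The horizontal
  conditions are the same ones, read with the inverse coefficients \<open>a\<^sub>1\<close> and \<open>a\<^sub>1 + 2tb\<^sub>1\<close>. Then
  \<open>\<lambda> = c\<^sub>1 / a\<^sub>1\<close>, and the factor \<open>t\<close> cancels in the equation for \<open>\<mu>\<close>, which leaves the smooth function
  \<open>\<mu> = (a\<^sub>1 d\<^sub>1 - c\<^sub>1 b\<^sub>1) / (a\<^sub>1 (a\<^sub>1 + 2tb\<^sub>1))\<close>.

  Since only vertical vectors are needed, it suffices to extend these to vector fields: the vertical
  lift of the differential of a smooth function supported in a chart does this.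
\<close>

section \<open>Calculus of smooth functions\<close>

text \<open>Accumulation along every basis direction makes derivatives within \<open>S\<close>
  unique. Open sets and the half-line both satisfy it, so one calculus serves for charts and for
  functions of the energy density.\<close>

definition unique_diff_set :: "'a::euclidean_space set \<Rightarrow> bool" where
  "unique_diff_set S \<longleftrightarrow>
     (\<forall>x\<in>S. \<forall>i\<in>Basis. \<forall>e>0. \<exists>d. 0 < \<bar>d\<bar> \<and> \<bar>d\<bar> < e \<and> x + d *\<^sub>R i \<in> S)"

lemma unique_diff_set_open:
  assumes "open S"
  shows "unique_diff_set S"
  unfolding unique_diff_set_def
proof (intro ballI allI impI)
  fix x i :: 'a and e :: real
  assume x: "x \<in> S" and i: "i \<in> Basis" and e: "e > 0"
  obtain r where r: "r > 0" "ball x r \<subseteq> S"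
    using assms x open_contains_ball by blast
  have "x + (min r e / 2) *\<^sub>R i \<in> ball x r"
    using r e i by (auto simp: dist_norm)
  then show "\<exists>d. 0 < \<bar>d\<bar> \<and> \<bar>d\<bar> < e \<and> x + d *\<^sub>R i \<in> S"
    using r e by (intro exI[of _ "min r e / 2"]) (auto simp: subset_eq)
qed

lemma unique_diff_set_atLeast: "unique_diff_set {a::real..}"
proof -
  have "0 < \<bar>e / 2\<bar> \<and> \<bar>e / 2\<bar> < e \<and> x + (e / 2) *\<^sub>R i \<in> {a..}"
    if "x \<ge> a" "e > 0" "i \<in> Basis" for x e i :: real
    using that by simp
  then show ?thesis
    unfolding unique_diff_set_def by (metis atLeast_iff)
qed

lemma frechet_derivative_eq:
  assumes "unique_diff_set S" "x \<in> S" "(f has_derivative f') (at x within S)"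
  shows "frechet_derivative f (at x within S) = f'"
proof (rule frechet_derivative_unique_within)
  show "(f has_derivative frechet_derivative f (at x within S)) (at x within S)"
    using assms(3) frechet_derivative_works differentiableI by blast
  show "(f has_derivative f') (at x within S)" by fact
  show "\<exists>d. 0 < \<bar>d\<bar> \<and> \<bar>d\<bar> < e \<and> x + d *\<^sub>R i \<in> S" if "i \<in> Basis" "e > 0" for i e
    using assms(1,2) that unfolding unique_diff_set_def by blast
qed

text \<open>Both functions have the same derivatives at \<open>x\<close>, so the choice operator
  inside \<open>frechet_derivative\<close> picks the same one.\<close>

lemma frechet_derivative_cong_within:
  assumes "\<And>y. y \<in> S \<Longrightarrow> f y = g y" "x \<in> S"
  shows "frechet_derivative f (at x within S) = frechet_derivative g (at x within S)"
proof -
  have "(f has_derivative f') (at x within S) \<longleftrightarrow> (g has_derivative f') (at x within S)" for f'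
    using assms has_derivative_transform by metis
  then show ?thesis
    unfolding frechet_derivative_def by presburger
qed

section \<open>Smoothness of finite order\<close>

text \<open>Differentiates \<open>f\<close> first and recurses on the directional derivatives,
  whereas \<open>iter_deriv\<close> adds each new derivative on the outside. This order suits
  inductions in which the derivative of a sum, product or composite is built from the same
  operations.\<close>

primrec smooth_upto ::
  "nat \<Rightarrow> 'a::real_normed_vector set \<Rightarrow> ('a \<Rightarrow> 'b::real_normed_vector) \<Rightarrow> bool" where
  "smooth_upto 0 S f \<longleftrightarrow> True"
| "smooth_upto (Suc n) S f \<longleftrightarrow>
     f differentiable_on S \<and> (\<forall>v. smooth_upto n S (\<lambda>x. frechet_derivative f (at x within S) v))"

lemma iter_deriv_snoc:
  "iter_deriv S (vs @ [v]) f = iter_deriv S vs (\<lambda>x. frechet_derivative f (at x within S) v)"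
  by (induction vs) auto

text \<open>Lists shorter than \<open>n\<close> suffice because differentiability of a derivative of
  order \<open>n - 1\<close> is the \<open>n\<close>-th one. Splitting lists at the end, by
  \<open>iter_deriv_snoc\<close>, matches the recursion of \<open>smooth_upto\<close>.\<close>

lemma smooth_upto_iff:
  "smooth_upto n S f \<longleftrightarrow> (\<forall>vs. length vs < n \<longrightarrow> iter_deriv S vs f differentiable_on S)"
proof (induction n arbitrary: f)
  case (Suc n)
  show ?case
  proof
    assume L: "smooth_upto (Suc n) S f"
    show "\<forall>vs. length vs < Suc n \<longrightarrow> iter_deriv S vs f differentiable_on S"
    proof (intro allI impI)
      fix vs :: "'a list"
      assume "length vs < Suc n"
      then show "iter_deriv S vs f differentiable_on S"
        using L Suc.IH by (cases vs rule: rev_cases) (auto simp: iter_deriv_snoc)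
    qed
  next
    assume R: "\<forall>vs. length vs < Suc n \<longrightarrow> iter_deriv S vs f differentiable_on S"
    have "iter_deriv S vs (\<lambda>x. frechet_derivative f (at x within S) v) differentiable_on S"
      if "length vs < n" for vs v
      using R[rule_format, of "vs @ [v]"] that by (simp add: iter_deriv_snoc)
    then show "smooth_upto (Suc n) S f"
      using R[rule_format, of "[]"] Suc.IH by auto
  qed
qed simp

lemma smooth_on_iff_upto: "smooth_on S f \<longleftrightarrow> (\<forall>n. smooth_upto n S f)"
  unfolding smooth_on_def smooth_upto_iff by blast

lemma smooth_on_imp_differentiable_on: "smooth_on S f \<Longrightarrow> f differentiable_on S"
  using smooth_on_iff_upto[of S f] by (metis smooth_upto.simps(2))

lemma smooth_on_directional_derivative:
  "smooth_on S f \<Longrightarrow> smooth_on S (\<lambda>x. frechet_derivative f (at x within S) v)"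
  unfolding smooth_on_iff_upto by (metis smooth_upto.simps(2))

lemma smooth_upto_mono: "smooth_upto n S f \<Longrightarrow> m \<le> n \<Longrightarrow> smooth_upto m S f"
  unfolding smooth_upto_iff by auto

text \<open>Derivatives are taken within \<open>S\<close>, so values off \<open>S\<close> never
  enter. Both functions are generalised because the induction hypothesis is applied to their
  derivatives.\<close>

lemma smooth_upto_cong:
  assumes "\<And>x. x \<in> S \<Longrightarrow> f x = g x" "smooth_upto n S f"
  shows "smooth_upto n S g"
  using assms
proof (induction n arbitrary: f g)
  case (Suc n)
  have "g differentiable_on S"
    unfolding differentiable_on_def
  proof
    fix x assume x: "x \<in> S"
    have "f differentiable (at x within S)"
      using Suc.prems(2) x by (simp add: differentiable_on_def)
    then show "g differentiable (at x within S)"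
      unfolding differentiable_def
      using has_derivative_transform[where f = f and g = g, OF x Suc.prems(1)[symmetric]] by blast
  qed
  moreover have "smooth_upto n S (\<lambda>x. frechet_derivative g (at x within S) v)" for v
  proof (rule Suc.IH)
    show "smooth_upto n S (\<lambda>x. frechet_derivative f (at x within S) v)"
      using Suc.prems by simp
    show "frechet_derivative f (at x within S) v = frechet_derivative g (at x within S) v"
      if "x \<in> S" for x
      using frechet_derivative_cong_within[of S f g x] Suc.prems that by simp
  qed
  ultimately show ?case by simp
qed simp

lemma smooth_on_cong: "smooth_on S f \<Longrightarrow> (\<And>x. x \<in> S \<Longrightarrow> f x = g x) \<Longrightarrow> smooth_on S g"
  unfolding smooth_on_iff_upto using smooth_upto_cong by metis

text \<open>Uniqueness of derivatives within \<open>S\<close> lets any explicit formula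
  \<open>f'\<close> replace the chosen derivative. The closure proofs below then only have to
  inspect the formula given by a derivative rule.\<close>

lemma smooth_upto_SucI:
  assumes "unique_diff_set S"
    and "\<And>x. x \<in> S \<Longrightarrow> (f has_derivative f' x) (at x within S)"
    and "\<And>v. smooth_upto n S (\<lambda>x. f' x v)"
  shows "smooth_upto (Suc n) S f"
proof -
  have "f differentiable_on S"
    using assms(2) unfolding differentiable_on_def differentiable_def by blast
  moreover have "smooth_upto n S (\<lambda>x. frechet_derivative f (at x within S) v)" for v
    by (rule smooth_upto_cong[OF _ assms(3)[of v]])
      (simp add: frechet_derivative_eq[OF assms(1) _ assms(2)])
  ultimately show ?thesis by simp
qed

lemma smooth_upto_SucD:
  assumes "smooth_upto (Suc n) S f" "x \<in> S"
  shows "(f has_derivative frechet_derivative f (at x within S)) (at x within S)"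
  using assms by (simp add: differentiable_on_def frechet_derivative_works)

section \<open>Closure under algebraic operations and composition\<close>

lemma smooth_upto_const: "unique_diff_set S \<Longrightarrow> smooth_upto n S (\<lambda>x. c)"
proof (induction n arbitrary: c)
  case (Suc n)
  show ?case
    by (rule smooth_upto_SucI[OF Suc.prems, where f' = "\<lambda>x v. 0"]) (auto intro: Suc)
qed simp

lemma smooth_upto_add:
  assumes "unique_diff_set S" "smooth_upto n S f" "smooth_upto n S g"
  shows "smooth_upto n S (\<lambda>x. f x + g x)"
  using assms(2,3)
proof (induction n arbitrary: f g)
  case (Suc n)
  show ?case
    by (rule smooth_upto_SucI[OF assms(1) has_derivative_add[OF smooth_upto_SucD smooth_upto_SucD]])
      (use Suc in auto)
qed simp

lemma smooth_upto_sum: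
  assumes "unique_diff_set S" "\<And>i. i \<in> I \<Longrightarrow> smooth_upto n S (f i)"
  shows "smooth_upto n S (\<lambda>x. \<Sum>i\<in>I. f i x)"
  using assms(2)
  by (induction I rule: infinite_finite_induct)
    (auto intro!: smooth_upto_const smooth_upto_add assms(1))

lemma smooth_upto_bounded_linear_compose:
  assumes "unique_diff_set S" "bounded_linear L" "smooth_upto n S f"
  shows "smooth_upto n S (\<lambda>x. L (f x))"
  using assms(3)
proof (induction n arbitrary: f)
  case (Suc n)
  show ?case
    by (rule smooth_upto_SucI[OF assms(1) bounded_linear.has_derivative[OF assms(2) smooth_upto_SucD]])
      (use Suc in auto)
qed simp

lemma smooth_upto_bounded_linear:
  assumes "unique_diff_set S" "bounded_linear L"
  shows "smooth_upto n S L"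
proof (cases n)
  case (Suc m)
  show ?thesis
    unfolding Suc
    by (rule smooth_upto_SucI[OF assms(1), where f' = "\<lambda>x. L"])
      (auto intro: smooth_upto_const assms bounded_linear.has_derivative[OF assms(2) has_derivative_ident])
qed simp

lemma smooth_upto_scaleR:
  assumes "unique_diff_set S" "smooth_upto n S f" "smooth_upto n S g"
  shows "smooth_upto n S (\<lambda>x. f x *\<^sub>R g x)"
  using assms(2,3)
proof (induction n arbitrary: f g)
  case (Suc n)
  \<comment> \<open>The product rule contains \<open>f\<close> and \<open>g\<close>
    undifferentiated, so their smoothness is lowered by one order.\<close>
  have "smooth_upto n S f" "smooth_upto n S g"
    using Suc.prems smooth_upto_mono by (metis le_Suc_eq order_refl)+
  then show ?case
    by (intro smooth_upto_SucI[OF assms(1) has_derivative_scaleR[OF smooth_upto_SucD smooth_upto_SucD]]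
        smooth_upto_add[OF assms(1)] Suc.IH) (use Suc.prems in auto)
qed simp

text \<open>The chain rule differentiates \<open>f\<close> in a direction that moves with
  \<open>x\<close>, while \<open>smooth_upto\<close> speaks of fixed directions. Expanding over
  \<open>Basis\<close> gives a sum of scalar components of the derivative of \<open>g\<close> times
  derivatives of \<open>f\<close> in fixed directions, to which the induction hypothesis
  applies.\<close>

lemma smooth_upto_compose:
  fixes f :: "'b::euclidean_space \<Rightarrow> 'c::real_normed_vector"
    and g :: "'a::euclidean_space \<Rightarrow> 'b"
  assumes "unique_diff_set S" "smooth_upto n T f" "smooth_upto n S g" "g ` S \<subseteq> T"
  shows "smooth_upto n S (\<lambda>x. f (g x))"
  using assms(2,3)
proof (induction n arbitrary: f)
  case (Suc n)
  let ?f' = "\<lambda>y. frechet_derivative f (at y within T)"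
  let ?g' = "\<lambda>x. frechet_derivative g (at x within S)"
  have f: "(f has_derivative ?f' y) (at y within T)" if "y \<in> T" for y
    using Suc.prems(1) that by (rule smooth_upto_SucD)
  have lin: "linear (?f' y)" if "y \<in> T" for y
    using f[OF that] has_derivative_linear by blast
  show ?case
  proof (rule smooth_upto_SucI[OF assms(1)])
    fix x assume x: "x \<in> S"
    then have gx: "g x \<in> T" using assms(4) by blast
    have "(f has_derivative ?f' (g x)) (at (g x) within g ` S)"
      using f[OF gx] assms(4) by (rule has_derivative_subset)
    from has_derivative_in_compose[OF smooth_upto_SucD[OF Suc.prems(2) x] this]
    have "((\<lambda>x. f (g x)) has_derivative (\<lambda>v. ?f' (g x) (?g' x v))) (at x within S)" .
    also have "(\<lambda>v. ?f' (g x) (?g' x v)) = (\<lambda>v. \<Sum>b\<in>Basis. (?g' x v \<bullet> b) *\<^sub>R ?f' (g x) b)"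
      using linear_sum[OF lin[OF gx], of "\<lambda>b. (?g' x v \<bullet> b) *\<^sub>R b" Basis for v]
      by (simp add: euclidean_representation linear_scale[OF lin[OF gx]])
    finally show "((\<lambda>x. f (g x)) has_derivative (\<lambda>v. \<Sum>b\<in>Basis. (?g' x v \<bullet> b) *\<^sub>R ?f' (g x) b))
        (at x within S)" .
  next
    fix v
    have "smooth_upto n S g"
      using Suc.prems smooth_upto_mono by (metis le_Suc_eq order_refl)
    then show "smooth_upto n S (\<lambda>x. \<Sum>b\<in>Basis. (?g' x v \<bullet> b) *\<^sub>R ?f' (g x) b)"
      using Suc.prems
      by (intro smooth_upto_sum smooth_upto_scaleR assms(1) Suc.IH
          smooth_upto_bounded_linear_compose[OF _ bounded_linear_inner_left]) auto
  qed
qed simp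

text \<open>The derivative of \<open>1/f\<close> is minus the square of \<open>1/f\<close> times the
  derivative of \<open>f\<close>, so order \<open>n\<close> for \<open>1/f\<close> yields order
  \<open>n + 1\<close>.\<close>

lemma smooth_upto_inverse:
  fixes f :: "'a::euclidean_space \<Rightarrow> real"
  assumes "unique_diff_set S" "smooth_upto n S f" "\<And>x. x \<in> S \<Longrightarrow> f x \<noteq> 0"
  shows "smooth_upto n S (\<lambda>x. inverse (f x))"
  using assms(2)
proof (induction n)
  case (Suc n)
  have "smooth_upto n S f"
    using Suc.prems smooth_upto_mono by (metis le_Suc_eq order_refl)
  then have i: "smooth_upto n S (\<lambda>x. inverse (f x))" by (rule Suc.IH)
  show ?case
  proof (rule smooth_upto_SucI[OF assms(1)])
    fix x assume x: "x \<in> S"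
    show "((\<lambda>x. inverse (f x)) has_derivative
        (\<lambda>v. inverse (f x) *\<^sub>R inverse (f x) *\<^sub>R (- 1) *\<^sub>R frechet_derivative f (at x within S) v)) (at x within S)"
      using Deriv.has_derivative_inverse[OF assms(3)[OF x] smooth_upto_SucD[OF Suc.prems x]]
      by (simp add: mult_ac)
  next
    fix v
    show "smooth_upto n S (\<lambda>x. inverse (f x) *\<^sub>R inverse (f x) *\<^sub>R (- 1) *\<^sub>R
        frechet_derivative f (at x within S) v)"
      using Suc.prems
      by (intro smooth_upto_scaleR assms(1) i smooth_upto_const) simp
  qed
qed simp

lemma
  assumes S: "unique_diff_set S"
  shows smooth_on_const: "smooth_on S (\<lambda>x. c)"
    and smooth_on_add: "smooth_on S f \<Longrightarrow> smooth_on S g \<Longrightarrow> smooth_on S (\<lambda>x. f x + g x)"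
    and smooth_on_bounded_linear: "bounded_linear L \<Longrightarrow> smooth_on S L"
    and smooth_on_scaleR: "smooth_on S h \<Longrightarrow> smooth_on S f \<Longrightarrow> smooth_on S (\<lambda>x. h x *\<^sub>R f x)"
  unfolding smooth_on_iff_upto
  by (auto intro: smooth_upto_const[OF S] smooth_upto_add[OF S] smooth_upto_bounded_linear[OF S]
      smooth_upto_scaleR[OF S])

lemma smooth_on_sum:
  assumes "unique_diff_set S" "\<And>i. i \<in> I \<Longrightarrow> smooth_on S (f i)"
  shows "smooth_on S (\<lambda>x. \<Sum>i\<in>I. f i x)"
  unfolding smooth_on_iff_upto
proof
  show "smooth_upto n S (\<lambda>x. \<Sum>i\<in>I. f i x)" for n
    by (rule smooth_upto_sum[OF assms(1)]) (use assms(2) in \<open>simp add: smooth_on_iff_upto\<close>)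
qed

lemma smooth_on_compose:
  fixes f :: "'b::euclidean_space \<Rightarrow> 'c::real_normed_vector"
    and g :: "'a::euclidean_space \<Rightarrow> 'b"
  assumes "unique_diff_set S" "smooth_on T f" "smooth_on S g" "g ` S \<subseteq> T"
  shows "smooth_on S (\<lambda>x. f (g x))"
  unfolding smooth_on_iff_upto
proof
  show "smooth_upto n S (\<lambda>x. f (g x))" for n
    using smooth_upto_compose[OF assms(1) assms(2,3)[unfolded smooth_on_iff_upto, rule_format] assms(4)] .
qed

lemma smooth_on_inverse:
  fixes f :: "'a::euclidean_space \<Rightarrow> real"
  assumes "unique_diff_set S" "smooth_on S f" "\<And>x. x \<in> S \<Longrightarrow> f x \<noteq> 0"
  shows "smooth_on S (\<lambda>x. inverse (f x))"
  unfolding smooth_on_iff_upto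
proof
  show "smooth_upto n S (\<lambda>x. inverse (f x))" for n
    by (rule smooth_upto_inverse[OF assms(1) _ assms(3)])
      (use assms(2) in \<open>simp_all add: smooth_on_iff_upto\<close>)
qed

lemma
  fixes f g :: "'a::euclidean_space \<Rightarrow> real"
  assumes S: "unique_diff_set S" and f: "smooth_on S f" and g: "smooth_on S g"
  shows smooth_on_mult: "smooth_on S (\<lambda>x. f x * g x)"
    and smooth_on_diff: "smooth_on S (\<lambda>x. f x - g x)"
    and smooth_on_divide: "(\<And>x. x \<in> S \<Longrightarrow> g x \<noteq> 0) \<Longrightarrow> smooth_on S (\<lambda>x. f x / g x)"
proof -
  show "smooth_on S (\<lambda>x. f x * g x)"
    using smooth_on_scaleR[OF S f g] by simp
  show "smooth_on S (\<lambda>x. f x - g x)"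
    using smooth_on_add[OF S f smooth_on_scaleR[OF S smooth_on_const[OF S, of "- 1"] g]] by simp
  show "smooth_on S (\<lambda>x. f x / g x)" if "\<And>x. x \<in> S \<Longrightarrow> g x \<noteq> 0"
    using smooth_on_scaleR[OF S f smooth_on_inverse[OF S g that]] by (simp add: divide_inverse)
qed

section \<open>Smoothness as a local property\<close>

text \<open>At a point of an open set, \<open>at x within U\<close> and \<open>at x within S\<close>
  are the same filter. Derivatives within \<open>U\<close> and within \<open>S\<close> therefore
  agree on \<open>U\<close>, and the hypothesis passes to derivatives.\<close>

lemma smooth_upto_locally:
  assumes "open S" and loc: "\<And>x. x \<in> S \<Longrightarrow> \<exists>U. open U \<and> x \<in> U \<and> U \<subseteq> S \<and> smooth_upto n U f"
  shows "smooth_upto n S f"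
  using loc
proof (induction n arbitrary: f)
  case (Suc n)
  have "f differentiable_on S"
    unfolding differentiable_on_def
  proof
    fix x assume x: "x \<in> S"
    then obtain U where U: "open U" "x \<in> U" "smooth_upto (Suc n) U f"
      using Suc.prems by blast
    then have "f differentiable (at x within U)"
      by (simp add: differentiable_on_def)
    then show "f differentiable (at x within S)"
      using at_within_open[OF x assms(1)] at_within_open[OF U(2,1)] by simp
  qed
  moreover have "smooth_upto n S (\<lambda>x. frechet_derivative f (at x within S) v)" for v
  proof (rule Suc.IH)
    fix x assume "x \<in> S"
    then obtain U where U: "open U" "x \<in> U" "U \<subseteq> S" "smooth_upto (Suc n) U f"
      using Suc.prems by blast
    have "smooth_upto n U (\<lambda>x. frechet_derivative f (at x within S) v)"
    proof (rule smooth_upto_cong)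
      show "smooth_upto n U (\<lambda>x. frechet_derivative f (at x within U) v)"
        using U by simp
      show "frechet_derivative f (at y within U) v = frechet_derivative f (at y within S) v"
        if "y \<in> U" for y
        using at_within_open[OF that U(1)] at_within_open[OF subsetD[OF U(3) that] assms(1)]
        by simp
    qed
    then show "\<exists>U. open U \<and> x \<in> U \<and> U \<subseteq> S \<and> smooth_upto n U (\<lambda>x. frechet_derivative f (at x within S) v)"
      using U by blast
  qed
  ultimately show ?case by simp
qed simp

lemma smooth_on_locally:
  assumes "open S" and "\<And>x. x \<in> S \<Longrightarrow> \<exists>U. open U \<and> x \<in> U \<and> U \<subseteq> S \<and> smooth_on U f"
  shows "smooth_on S f"
  unfolding smooth_on_iff_upto
proof
  fix n
  have "\<exists>U. open U \<and> x \<in> U \<and> U \<subseteq> S \<and> smooth_upto n U f" if "x \<in> S" for x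
    using assms(2)[OF that] unfolding smooth_on_iff_upto by blast
  then show "smooth_upto n S f"
    by (rule smooth_upto_locally[OF assms(1)])
qed

section \<open>Flat functions and localisation in a ball\<close>

text \<open>The family over all \<open>k\<close> is closed under differentiation up to linear
  combinations; \<open>k = 0\<close> is the usual flat function.\<close>

definition flat_exp :: "nat \<Rightarrow> real \<Rightarrow> real" where
  "flat_exp k x = (if x > 0 then inverse x ^ k * exp (- inverse x) else 0)"

lemma flat_exp_has_derivative:
  "(flat_exp k has_real_derivative (flat_exp (k + 2) x - real k * flat_exp (k + 1) x)) (at x)"
proof -
  consider "x > 0" | "x = 0" | "x < 0" by linarith
  then show ?thesis
  proof cases
    case 1
    let ?y = "inverse x"
    have "((\<lambda>x. inverse x ^ k * exp (- inverse x)) has_real_derivative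
        real k * ?y ^ (k - 1) * (- (?y * ?y)) * exp (- ?y) + ?y ^ k * (exp (- ?y) * (?y * ?y))) (at x)"
      using 1 by (auto intro!: derivative_eq_intros simp: mult_ac)
    also have "real k * ?y ^ (k - 1) * (- (?y * ?y)) * exp (- ?y) + ?y ^ k * (exp (- ?y) * (?y * ?y)) =
        flat_exp (k + 2) x - real k * flat_exp (k + 1) x"
      \<comment> \<open>The exponent \<open>k - 1\<close> is truncated at \<open>k = 0\<close>,
        where the factor \<open>real k\<close> removes the term.\<close>
      using 1 by (cases k) (simp_all add: flat_exp_def algebra_simps)
    finally have "((\<lambda>x. inverse x ^ k * exp (- inverse x)) has_real_derivative
        (flat_exp (k + 2) x - real k * flat_exp (k + 1) x)) (at x)" .
    then show ?thesis
      by (rule has_field_derivative_transform_within_open[where S = "{0<..}"])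
        (use 1 in \<open>auto simp: flat_exp_def\<close>)
  next
    case 2
    \<comment> \<open>At zero the difference quotient is \<open>flat_exp k y / y\<close>. It
      vanishes on the left, and on the right passing to \<open>inverse y\<close> turns it into a
      power divided by an exponential at infinity.\<close>
    have "((\<lambda>y. flat_exp k y / y) \<longlongrightarrow> 0) (at_left 0)"
      by (rule tendsto_eventually) (auto simp: flat_exp_def eventually_at_filter)
    moreover have "((\<lambda>y. inverse y ^ (k + 1) * exp (- inverse y)) \<longlongrightarrow> (0::real)) (at_right 0)"
    proof -
      have "((\<lambda>y::real. y ^ (k + 1) / exp y) \<longlongrightarrow> 0) at_top"
        by (rule tendsto_power_div_exp_0)
      then have "((\<lambda>y::real. inverse y ^ (k + 1) / exp (inverse y)) \<longlongrightarrow> 0) (at_right 0)"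
        by (rule filterlim_compose[OF _ filterlim_inverse_at_top_right])
      then show ?thesis by (simp add: exp_minus divide_inverse)
    qed
    then have "((\<lambda>y. flat_exp k y / y) \<longlongrightarrow> 0) (at_right 0)"
      by (rule Lim_transform_eventually)
        (auto simp: flat_exp_def eventually_at_filter divide_inverse mult_ac)
    ultimately have "((\<lambda>y. flat_exp k y / y) \<longlongrightarrow> 0) (at 0)"
      by (simp add: filterlim_split_at)
    then show ?thesis
      using 2 by (simp add: has_field_derivative_iff flat_exp_def)
  next
    case 3
    have "((\<lambda>x. 0) has_real_derivative 0) (at x)" by simp
    then have "(flat_exp k has_real_derivative 0) (at x)"
      by (rule has_field_derivative_transform_within_open[where S = "{..<0}"])
        (use 3 in \<open>auto simp: flat_exp_def\<close>)
    then show ?thesis using 3 by (simp add: flat_exp_def)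
  qed
qed

lemma smooth_upto_flat_exp: "smooth_upto n UNIV (flat_exp k)"
proof (induction n arbitrary: k)
  case (Suc n)
  have U: "unique_diff_set (UNIV :: real set)"
    by (simp add: unique_diff_set_open)
  show ?case
  proof (rule smooth_upto_SucI[OF U])
    fix x :: real
    show "(flat_exp k has_derivative
        (\<lambda>v. v *\<^sub>R (flat_exp (k + 2) x + (- real k) *\<^sub>R flat_exp (k + 1) x))) (at x within UNIV)"
      by (rule has_derivative_eq_rhs[OF flat_exp_has_derivative[unfolded has_field_derivative_def]])
        (simp add: fun_eq_iff mult.commute)
    show "smooth_upto n UNIV (\<lambda>x. v *\<^sub>R (flat_exp (k + 2) x + (- real k) *\<^sub>R flat_exp (k + 1) x))"
      for v
      by (intro smooth_upto_scaleR smooth_upto_add smooth_upto_const U Suc)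
  qed
qed simp

text \<open>The affine function with gradient \<open>k\<close> that vanishes at \<open>a\<close> is
  multiplied by the radial bump \<open>exp (- 1/s)\<close>, \<open>s = r^2 - |y - a|^2\<close>,
  divided by its value at \<open>a\<close>. At \<open>a\<close> the derivative of the bump drops out
  of the product rule, since the affine factor is zero there.\<close>

lemma smooth_function_in_ball:
  fixes a k :: "'a::euclidean_space"
  assumes r: "r > 0"
  obtains B :: "'a \<Rightarrow> real" where "smooth_on UNIV B" "\<And>y. y \<notin> ball a r \<Longrightarrow> B y = 0"
    "(B has_derivative (\<lambda>v. k \<bullet> v)) (at a)"
proof
  let ?s = "\<lambda>y. r\<^sup>2 - (y - a) \<bullet> (y - a)"
  let ?B = "\<lambda>y. flat_exp 0 (?s y) * ((k /\<^sub>R flat_exp 0 (r\<^sup>2)) \<bullet> (y - a))"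
  have U: "unique_diff_set (UNIV :: 'a set)"
    by (simp add: unique_diff_set_open)
  have lin: "smooth_on UNIV (\<lambda>y::'a. u \<bullet> (y - a))" for u
    using smooth_on_diff[OF U smooth_on_bounded_linear[OF U bounded_linear_inner_right[of u]]
        smooth_on_const[OF U, of "u \<bullet> a"]]
    by (simp add: inner_diff_right)
  have "smooth_on UNIV (\<lambda>y::'a. \<Sum>b\<in>Basis. (b \<bullet> (y - a)) * (b \<bullet> (y - a)))"
    by (intro smooth_on_sum smooth_on_mult U lin)
  then have "smooth_on UNIV (\<lambda>y::'a. (y - a) \<bullet> (y - a))"
    by (simp add: euclidean_inner[of "_ - a"] inner_commute)
  then have s: "smooth_on UNIV ?s"
    by (intro smooth_on_diff smooth_on_const U)
  have h: "smooth_on UNIV (\<lambda>y. flat_exp 0 (?s y))"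
    by (rule smooth_on_compose[OF U _ s, where T = UNIV])
      (simp_all add: smooth_on_iff_upto smooth_upto_flat_exp)
  show "smooth_on UNIV ?B"
    by (rule smooth_on_mult[OF U h lin])
  show "?B y = 0" if "y \<notin> ball a r" for y
  proof -
    have "r \<le> norm (y - a)" using that by (simp add: dist_norm norm_minus_commute)
    then have "r\<^sup>2 \<le> (norm (y - a))\<^sup>2" using r by (simp add: power_mono)
    then show ?thesis by (simp add: flat_exp_def power2_norm_eq_inner)
  qed
  have "(\<lambda>y. flat_exp 0 (?s y)) differentiable (at a)"
    using smooth_on_imp_differentiable_on[OF h] by (simp add: differentiable_on_def)
  then obtain D where D: "((\<lambda>y. flat_exp 0 (?s y)) has_derivative D) (at a)"
    by (auto simp: differentiable_def)
  have "flat_exp 0 (r\<^sup>2) \<noteq> 0" using r by (simp add: flat_exp_def)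
  then show "(?B has_derivative (\<lambda>v. k \<bullet> v)) (at a)"
    by (auto intro!: derivative_eq_intros D)
qed

section \<open>Tangent spaces\<close>

text \<open>Keeps of an atlas only what the algebra of tangent vectors uses: injective charts, open
  overlaps and differentiable transitions, with no topology on the points. The cotangent atlas can
  then be an instance as well.\<close>

locale diff_atlas =
  fixes A :: "('m, 'e::euclidean_space) chart set"
  assumes inj_chart: "c \<in> A \<Longrightarrow> inj_on (snd c) (fst c)"
    and open_overlap: "c \<in> A \<Longrightarrow> d \<in> A \<Longrightarrow> open (snd c ` (fst c \<inter> fst d))"
    and differentiable_transition:
      "c \<in> A \<Longrightarrow> d \<in> A \<Longrightarrow> (snd d \<circ> chart_inv c) differentiable_on snd c ` (fst c \<inter> fst d)"
begin

lemma chart_inv_chart [simp]: "c \<in> A \<Longrightarrow> x \<in> fst c \<Longrightarrow> chart_inv c (snd c x) = x"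
  by (simp add: inj_chart)

lemma transition_has_derivative:
  assumes "c \<in> A" "d \<in> A" "x \<in> fst c" "x \<in> fst d"
  shows "((snd d \<circ> chart_inv c) has_derivative
     frechet_derivative (snd d \<circ> chart_inv c) (at (snd c x))) (at (snd c x))"
proof -
  have x: "snd c x \<in> snd c ` (fst c \<inter> fst d)" using assms by blast
  then have "(snd d \<circ> chart_inv c) differentiable (at (snd c x))"
    using differentiable_transition[OF assms(1,2)] at_within_open[OF x open_overlap[OF assms(1,2)]]
    by (metis differentiable_on_def)
  then show ?thesis using frechet_derivative_works by blast
qed

lemma linear_coord_vec:
  assumes "c \<in> A" "x \<in> fst c"
  shows "linear (coord_vec A c x)"
proof (rule linearI)
  have "linear (frechet_derivative (snd d \<circ> chart_inv c) (at (snd c x)))" if "d \<in> A" "x \<in> fst d" for d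
    using transition_has_derivative[OF assms(1) that(1) assms(2) that(2)] has_derivative_linear by blast
  then show "coord_vec A c x (u + v) = coord_vec A c x u + coord_vec A c x v"
    and "coord_vec A c x (r *\<^sub>R u) = r *\<^sub>R coord_vec A c x u" for u v r
    by (auto simp: coord_vec_def fun_eq_iff linear_add linear_scale scaleR_fun_def)
qed

lemma coord_vec_self:
  assumes "c \<in> A" "x \<in> fst c"
  shows "coord_vec A c x u c = u"
proof -
  have op: "open (snd c ` fst c)" using open_overlap[of c c] assms by simp
  have "((\<lambda>q. q) has_derivative (\<lambda>v. v)) (at (snd c x))" by simp
  then have "((snd c \<circ> chart_inv c) has_derivative (\<lambda>v. v)) (at (snd c x))"
    by (rule has_derivative_transform_within_open[OF _ op])
      (use assms in \<open>auto simp: f_inv_into_f\<close>)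
  then have "frechet_derivative (snd c \<circ> chart_inv c) (at (snd c x)) = (\<lambda>v. v)"
    using frechet_derivative_at by metis
  then show ?thesis using assms by (simp add: coord_vec_def)
qed

text \<open>The chain rule for composed transition maps. In charts not around \<open>x\<close> both
  sides are zero by convention.\<close>

lemma coord_vec_coord_vec:
  assumes "c \<in> A" "d \<in> A" "x \<in> fst c" "x \<in> fst d"
  shows "coord_vec A d x (coord_vec A c x u d) = coord_vec A c x u"
proof
  fix e
  show "coord_vec A d x (coord_vec A c x u d) e = coord_vec A c x u e"
  proof (cases "e \<in> A \<and> x \<in> fst e")
    case True
    let ?D = "\<lambda>c d. frechet_derivative (snd d \<circ> chart_inv c) (at (snd c x))"
    have "((snd e \<circ> chart_inv d) has_derivative ?D d e) (at ((snd d \<circ> chart_inv c) (snd c x)))"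
      using transition_has_derivative[of d e x] assms True by simp
    from diff_chain_at[OF transition_has_derivative[OF assms] this]
    have "((snd e \<circ> chart_inv d) \<circ> (snd d \<circ> chart_inv c) has_derivative ?D d e \<circ> ?D c d) (at (snd c x))" .
    then have "((snd e \<circ> chart_inv c) has_derivative ?D d e \<circ> ?D c d) (at (snd c x))"
      by (rule has_derivative_transform_within_open[OF _ open_overlap[OF assms(1,2)]])
        (use assms in auto)
    then have "?D c e = ?D d e \<circ> ?D c d"
      using frechet_derivative_at by metis
    then show ?thesis using True assms by (simp add: coord_vec_def)
  next
    case False
    then have "coord_vec A c x u e = 0" for c u unfolding coord_vec_def by meson
    then show ?thesis by simp
  qed
qed

lemma coord_vec_in_tangent_space:
  assumes "c \<in> A" "x \<in> fst c"
  shows "coord_vec A c x u \<in> tangent_space A x"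
  unfolding tangent_space_def using coord_vec_coord_vec[OF assms(1) _ assms(2)]
  by (auto simp: coord_vec_def)

lemma tangent_space_coord_vec:
  assumes "c \<in> A" "x \<in> fst c" "v \<in> tangent_space A x"
  shows "v = coord_vec A c x (v c)"
  using assms by (auto simp: tangent_space_def)

lemma tangent_space_eq_range:
  assumes "c \<in> A" "x \<in> fst c"
  shows "tangent_space A x = range (coord_vec A c x)"
proof
  show "tangent_space A x \<subseteq> range (coord_vec A c x)"
    using tangent_space_coord_vec[OF assms] by (metis rangeI subsetI)
qed (auto intro: coord_vec_in_tangent_space assms)

lemma subspace_tangent_space:
  assumes "c \<in> A" "x \<in> fst c"
  shows "subspace (tangent_space A x)"
  unfolding tangent_space_eq_range[OF assms]
  by (rule linear_subspace_image[OF linear_coord_vec[OF assms] subspace_UNIV])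

end

lemma open_chart_image_Int:
  assumes "smooth_atlas A" "c \<in> A" "open W"
  shows "open (snd c ` (fst c \<inter> W))"
proof -
  have h: "homeomorphism (fst c) (snd c ` fst c) (snd c) (chart_inv c)" and o: "open (snd c ` fst c)"
    using assms unfolding smooth_atlas_def by blast+
  have "openin (top_of_set (snd c ` fst c)) (snd c ` (fst c \<inter> W))"
    by (rule homeomorphism_imp_open_map[OF h openin_open_Int[OF assms(3)]])
  then show ?thesis using o openin_open_trans by blast
qed

lemma smooth_atlas_imp_diff_atlas:
  assumes "smooth_atlas A"
  shows "diff_atlas A"
proof
  fix c d assume c: "c \<in> A" and d: "d \<in> A"
  have h: "homeomorphism (fst c) (snd c ` fst c) (snd c) (chart_inv c)" and "open (fst d)"
    and s: "smooth_on (snd c ` (fst c \<inter> fst d)) (snd d \<circ> chart_inv c)"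
    using assms c d unfolding smooth_atlas_def by blast+
  show "inj_on (snd c) (fst c)"
    using h by (metis homeomorphism_apply1 inj_on_inverseI)
  show "open (snd c ` (fst c \<inter> fst d))"
    using open_chart_image_Int assms c \<open>open (fst d)\<close> by blast
  show "(snd d \<circ> chart_inv c) differentiable_on snd c ` (fst c \<inter> fst d)"
    using s by (rule smooth_on_imp_differentiable_on)
qed

section \<open>The cotangent bundle as a manifold\<close>

text \<open>Inverse to taking momenta in the chart \<open>c\<close>. The value zero off the tangent
  space is the normal form that \<open>cotangent_space\<close> prescribes.\<close>

definition covector_of ::
  "('m, 'e::euclidean_space) chart set \<Rightarrow> ('m, 'e) chart \<Rightarrow> 'm \<Rightarrow> 'e \<Rightarrow> ('m, 'e) covec" where
  "covector_of A c x p = (\<lambda>v. if v \<in> tangent_space A x then p \<bullet> v c else 0)"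

context diff_atlas
begin

lemma covector_of_in_cotangent_space:
  assumes "c \<in> A" "x \<in> fst c"
  shows "covector_of A c x p \<in> cotangent_space A x"
proof -
  have "r *\<^sub>R v + w \<in> tangent_space A x" if "v \<in> tangent_space A x" "w \<in> tangent_space A x" for r v w
    using subspace_tangent_space[OF assms] that by (intro subspace_add subspace_scale)
  then show ?thesis
    by (simp add: cotangent_space_def covector_of_def) (simp add: scaleR_fun_def inner_add_right)
qed

lemma covector_eqI:
  assumes c: "c \<in> A" "x \<in> fst c"
    and w: "\<omega> \<in> cotangent_space A x" "\<omega>' \<in> cotangent_space A x"
    and eq: "\<And>b. b \<in> Basis \<Longrightarrow> \<omega> (coord_vec A c x b) = \<omega>' (coord_vec A c x b)"
  shows "\<omega> = \<omega>'"
proof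
  fix v
  have lin: "linear (\<lambda>u. \<eta> (coord_vec A c x u))" if "\<eta> \<in> cotangent_space A x" for \<eta>
  proof -
    have L: "\<eta> (r *\<^sub>R v + w) = r * \<eta> v + \<eta> w" if "v \<in> tangent_space A x" "w \<in> tangent_space A x" for r v w
      using \<open>\<eta> \<in> cotangent_space A x\<close> that unfolding cotangent_space_def by blast
    have z: "(0::('m, 'e) tvec) \<in> tangent_space A x"
      using subspace_tangent_space[OF c] subspace_0 by blast
    have "\<eta> 0 = 0" using L[OF z z, of 1] by simp
    then show ?thesis
      using L[OF coord_vec_in_tangent_space[OF c] coord_vec_in_tangent_space[OF c], of 1]
        L[OF coord_vec_in_tangent_space[OF c] z]
      by (intro linearI) (simp_all add: linear_add[OF linear_coord_vec[OF c]] linear_scale[OF linear_coord_vec[OF c]])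
  qed
  show "\<omega> v = \<omega>' v"
  proof (cases "v \<in> tangent_space A x")
    case True
    have "(\<lambda>u. \<omega> (coord_vec A c x u)) = (\<lambda>u. \<omega>' (coord_vec A c x u))"
      by (rule linear_eq_stdbasis[OF lin[OF w(1)] lin[OF w(2)]]) (rule eq)
    then show ?thesis
      using tangent_space_coord_vec[OF c True] by metis
  next
    case False
    then show ?thesis using w by (simp add: cotangent_space_def)
  qed
qed

end

section \<open>Induced charts and their transition maps\<close>

lemma fst_cotangent_chart: "fst (cotangent_chart A c) = {P \<in> cotangent_bundle A. fst P \<in> fst c}"
  and snd_cotangent_chart: "snd (cotangent_chart A c) P = (snd c (fst P), momentum A c P)"
  by (simp_all add: cotangent_chart_def)

locale smooth_manifold =
  fixes A :: "('m::{t2_space, second_countable_topology}, real^'n) chart set"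
  assumes atlas: "smooth_atlas A"
begin

sublocale diff_atlas A
  using atlas by (rule smooth_atlas_imp_diff_atlas)

lemma momentum_covector_of:
  assumes "c \<in> A" "x \<in> fst c" "d \<in> A" "x \<in> fst d"
  shows "momentum A d (x, covector_of A c x p) = (\<chi> i. p \<bullet> coord_vec A d x (axis i 1) c)"
  using assms coord_vec_in_tangent_space by (simp add: momentum_def covector_of_def)

lemma momentum_covector_of_self:
  assumes "c \<in> A" "x \<in> fst c"
  shows "momentum A c (x, covector_of A c x p) = p"
  using assms by (simp add: momentum_covector_of coord_vec_self inner_axis vec_eq_iff)

lemma covector_of_momentum:
  assumes "c \<in> A" "x \<in> fst c" "\<omega> \<in> cotangent_space A x"
  shows "covector_of A c x (momentum A c (x, \<omega>)) = \<omega>"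
proof (rule covector_eqI[OF assms(1,2) covector_of_in_cotangent_space[OF assms(1,2)] assms(3)])
  fix b :: "real^'n" assume "b \<in> Basis"
  then obtain i where b: "b = axis i 1" by (auto simp: Basis_vec_def)
  show "covector_of A c x (momentum A c (x, \<omega>)) (coord_vec A c x b) = \<omega> (coord_vec A c x b)"
    using coord_vec_in_tangent_space[OF assms(1,2)]
    by (simp add: covector_of_def coord_vec_self assms inner_axis momentum_def b)
qed

lemma in_cotangent_chart_iff:
  assumes "c \<in> A"
  shows "P \<in> fst (cotangent_chart A c) \<longleftrightarrow> fst P \<in> fst c \<and> snd P \<in> cotangent_space A (fst P)"
  using assms by (cases P) (auto simp: fst_cotangent_chart cotangent_bundle_def)

text \<open>The zero covector lies over every point, so a base chart can be read off its induced
  chart. This lets \<open>vertical_vector_field\<close> recover base charts.\<close>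

lemma inj_on_cotangent_chart: "inj_on (cotangent_chart A) A"
proof (rule inj_onI)
  fix c d assume c: "c \<in> A" and d: "d \<in> A" and eq: "cotangent_chart A c = cotangent_chart A d"
  have "x \<in> fst c \<longleftrightarrow> (x, \<lambda>v. 0) \<in> fst (cotangent_chart A c)" if "c \<in> A" for c x
    using that by (simp add: in_cotangent_chart_iff) (simp add: cotangent_space_def)
  then have "fst c = fst d" using c d eq by (metis subsetI subset_antisym)
  \<comment> \<open>Holds also off the domains, because the coordinate map of an induced chart is
    given by one formula on all pairs.\<close>
  moreover have "snd c x = snd d x" for x
    using arg_cong[OF eq, of "\<lambda>C. fst (snd C (x, \<lambda>v. 0))"] by (simp add: snd_cotangent_chart)
  ultimately show "c = d" by (simp add: prod_eq_iff fun_eq_iff)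
qed

lemma inj_on_snd_cotangent_chart:
  assumes "c \<in> A"
  shows "inj_on (snd (cotangent_chart A c)) (fst (cotangent_chart A c))"
proof (rule inj_onI)
  fix P Q assume P: "P \<in> fst (cotangent_chart A c)" and Q: "Q \<in> fst (cotangent_chart A c)"
    and eq: "snd (cotangent_chart A c) P = snd (cotangent_chart A c) Q"
  from eq P Q inj_chart[OF assms] have 1: "fst P = fst Q"
    by (auto simp: snd_cotangent_chart in_cotangent_chart_iff assms dest: inj_onD)
  have "snd P = covector_of A c (fst P) (momentum A c P)" "snd Q = covector_of A c (fst Q) (momentum A c Q)"
    using covector_of_momentum[OF assms, of "fst P" "snd P"] covector_of_momentum[OF assms, of "fst Q" "snd Q"] P Q
    by (auto simp: in_cotangent_chart_iff assms)
  with 1 eq show "P = Q" by (simp add: snd_cotangent_chart prod_eq_iff)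
qed

lemma cotangent_chart_inv:
  assumes "c \<in> A" "q \<in> snd c ` fst c"
  shows "chart_inv (cotangent_chart A c) (q, p) = (chart_inv c q, covector_of A c (chart_inv c q) p)"
proof -
  obtain x where x: "x \<in> fst c" "q = snd c x" using assms by blast
  have "(x, covector_of A c x p) \<in> fst (cotangent_chart A c)"
    using x assms by (simp add: in_cotangent_chart_iff covector_of_in_cotangent_space)
  from inv_into_f_f[OF inj_on_snd_cotangent_chart[OF assms(1)] this] show ?thesis
    using x assms by (simp add: snd_cotangent_chart momentum_covector_of_self)
qed

lemma cotangent_chart_image:
  assumes "c \<in> A" "d \<in> A"
  shows "snd (cotangent_chart A c) ` (fst (cotangent_chart A c) \<inter> fst (cotangent_chart A d)) =
    snd c ` (fst c \<inter> fst d) \<times> UNIV" (is "?L = ?R")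
proof
  show "?L \<subseteq> ?R"
    using assms by (auto simp: snd_cotangent_chart in_cotangent_chart_iff)
  show "?R \<subseteq> ?L"
  proof
    fix z assume "z \<in> ?R"
    then obtain x p where x: "x \<in> fst c" "x \<in> fst d" "z = (snd c x, p)" by auto
    then have "z = snd (cotangent_chart A c) (x, covector_of A c x p)"
      using assms by (simp add: snd_cotangent_chart momentum_covector_of_self)
    then show "z \<in> ?L"
      using x assms
      by (intro image_eqI[where x = "(x, covector_of A c x p)"])
        (auto simp: in_cotangent_chart_iff covector_of_in_cotangent_space)
  qed
qed

text \<open>In coordinates the transition is \<open>\<phi>\<close> on positions and, on momenta, the
  pairing with the columns of the Jacobian of the inverse transition \<open>\<psi>\<close>. Being
  linear in the momenta, it sends a fibre direction \<open>(0, w)\<close> to the same pairing with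
  \<open>w\<close>. Differentiating the Jacobian takes second derivatives of \<open>\<psi>\<close>,
  supplied by smoothness of the atlas.\<close>

lemma cotangent_transition_has_derivative:
  assumes c: "c \<in> A" and d: "d \<in> A" and x: "x \<in> fst c" "x \<in> fst d"
  obtains D where
    "((snd (cotangent_chart A d) \<circ> chart_inv (cotangent_chart A c)) has_derivative D) (at (snd c x, p))"
    "\<And>w. D (0, w) = (0, \<chi> i. w \<bullet> coord_vec A d x (axis i 1) c)"
proof -
  let ?\<phi> = "snd d \<circ> chart_inv c" and ?\<psi> = "snd c \<circ> chart_inv d"
  let ?m = "\<lambda>i q. frechet_derivative ?\<psi> (at (?\<phi> q)) (axis i 1)"
  let ?S = "snd c ` (fst c \<inter> fst d)" and ?T = "snd d ` (fst d \<inter> fst c)"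
  have S: "open ?S" and T: "open ?T"
    using open_overlap c d by blast+
  define \<phi>' where "\<phi>' = frechet_derivative ?\<phi> (at (snd c x))"
  have \<phi>: "(?\<phi> has_derivative \<phi>') (at (snd c x))"
    unfolding \<phi>'_def by (rule transition_has_derivative[OF c d x])
  have "smooth_on ?T ?\<psi>" using atlas c d unfolding smooth_atlas_def by blast
  then have "(\<lambda>r. frechet_derivative ?\<psi> (at r within ?T) (axis i 1)) differentiable_on ?T" for i
    by (rule smooth_on_imp_differentiable_on[OF smooth_on_directional_derivative])
  moreover have dx: "snd d x \<in> ?T" using x by blast
  ultimately have "(\<lambda>r. frechet_derivative ?\<psi> (at r within ?T) (axis i 1)) differentiable (at (snd d x))" for i
    using at_within_open[OF dx T] by (metis differentiable_on_def)
  then have "\<exists>D. ((\<lambda>r. frechet_derivative ?\<psi> (at r within ?T) (axis i 1)) has_derivative D) (at (snd d x))" for i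
    by (simp add: differentiable_def)
  then obtain D where D:
    "((\<lambda>r. frechet_derivative ?\<psi> (at r within ?T) (axis i 1)) has_derivative D i) (at (snd d x))" for i
    by metis
  have "((\<lambda>r. frechet_derivative ?\<psi> (at r) (axis i 1)) has_derivative D i) (at (?\<phi> (snd c x)))" for i
  proof -
    have "((\<lambda>r. frechet_derivative ?\<psi> (at r) (axis i 1)) has_derivative D i) (at (snd d x))"
      by (rule has_derivative_transform_within_open[OF D[of i] T dx]) (simp add: at_within_open[OF _ T])
    then show ?thesis using c x by simp
  qed
  from diff_chain_at[OF \<phi> this]
  have m: "(?m i has_derivative D i \<circ> \<phi>') (at (snd c x))" for i
    by (simp add: o_def)
  \<comment> \<open>The transition in closed form, valid on the open set over the overlap. In
    \<open>F'\<close> the term with \<open>D i\<close> comes from the varying Jacobian and vanishes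
    when \<open>fst h = 0\<close>.\<close>
  define F where "F = (\<lambda>z. (?\<phi> (fst z), \<chi> i. snd z \<bullet> ?m i (fst z)))"
  define F' where "F' = (\<lambda>h. (\<phi>' (fst h), \<chi> i. p \<bullet> D i (\<phi>' (fst h)) + snd h \<bullet> ?m i (snd c x)))"
  have fst': "(fst has_derivative fst) (at (snd c x, p))" and snd': "(snd has_derivative snd) (at (snd c x, p))"
    by (rule has_derivative_fst has_derivative_snd, rule has_derivative_ident)+
  have comp: "((\<lambda>z. f (fst z)) has_derivative (\<lambda>h. f' (fst h))) (at (snd c x, p))"
    if "(f has_derivative f') (at (snd c x))" for f :: "real^'n \<Rightarrow> real^'n" and f'
    using diff_chain_at[OF fst', of f f'] that by (simp add: o_def)
  have inner: "((\<lambda>z. snd z \<bullet> ?m i (fst z)) has_derivative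
      (\<lambda>h. p \<bullet> D i (\<phi>' (fst h)) + snd h \<bullet> ?m i (snd c x))) (at (snd c x, p))" for i
    using has_derivative_inner[OF snd' comp[OF m[of i]]] by simp
  have "((\<lambda>z. \<chi> i. snd z \<bullet> ?m i (fst z)) has_derivative
      (\<lambda>h. \<chi> i. p \<bullet> D i (\<phi>' (fst h)) + snd h \<bullet> ?m i (snd c x))) (at (snd c x, p))"
    unfolding has_derivative_componentwise_within[of "\<lambda>z. \<chi> i. snd z \<bullet> ?m i (fst z)"]
    using inner by (auto simp: Basis_vec_def inner_axis)
  then have "(F has_derivative F') (at (snd c x, p))"
    unfolding F_def F'_def by (intro has_derivative_Pair comp[OF \<phi>])
  then have "((snd (cotangent_chart A d) \<circ> chart_inv (cotangent_chart A c)) has_derivative F') (at (snd c x, p))"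
  proof (rule has_derivative_transform_within_open)
    show "open (?S \<times> (UNIV :: (real^'n) set))" by (intro open_Times S open_UNIV)
    show "(snd c x, p) \<in> ?S \<times> UNIV" using x by blast
    show "F z = (snd (cotangent_chart A d) \<circ> chart_inv (cotangent_chart A c)) z" if "z \<in> ?S \<times> UNIV" for z
    proof -
      have "fst z \<in> ?S" using that by (simp add: mem_Times_iff)
      then obtain y where "y \<in> fst c" "y \<in> fst d" "fst z = snd c y" by blast
      then obtain w where y: "y \<in> fst c" "y \<in> fst d" "z = (snd c y, w)"
        by (metis prod.collapse)
      then show ?thesis
        using c d by (simp add: F_def cotangent_chart_inv snd_cotangent_chart momentum_covector_of coord_vec_def)
    qed
  qed
  moreover have "F' (0, w) = (0, \<chi> i. w \<bullet> coord_vec A d x (axis i 1) c)" for w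
  proof -
    have "\<phi>' 0 = 0" "D i 0 = 0" for i
      using \<phi> D[of i] has_derivative_linear linear_0 by blast+
    then show ?thesis using c d x by (simp add: F'_def coord_vec_def)
  qed
  ultimately show thesis by (rule that)
qed

sublocale cot: diff_atlas "cotangent_atlas A"
proof
  fix C C' assume "C \<in> cotangent_atlas A" "C' \<in> cotangent_atlas A"
  then obtain c d where c: "c \<in> A" "C = cotangent_chart A c" and d: "d \<in> A" "C' = cotangent_chart A d"
    by (auto simp: cotangent_atlas_def)
  show "inj_on (snd C) (fst C)" using inj_on_snd_cotangent_chart c by blast
  show op: "open (snd C ` (fst C \<inter> fst C'))"
    using c d by (simp add: cotangent_chart_image open_Times open_overlap)
  show "(snd C' \<circ> chart_inv C) differentiable_on snd C ` (fst C \<inter> fst C')"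
    unfolding differentiable_on_def
  proof
    fix z assume z: "z \<in> snd C ` (fst C \<inter> fst C')"
    then obtain x p where "x \<in> fst c" "x \<in> fst d" "z = (snd c x, p)"
      using c d by (auto simp: cotangent_chart_image)
    then show "(snd C' \<circ> chart_inv C) differentiable at z within snd C ` (fst C \<inter> fst C')"
      using cotangent_transition_has_derivative[of c d x p] c d at_within_open[OF z op]
      by (metis differentiable_def)
  qed
qed

text \<open>Vertical vectors stay vertical and change charts like momenta, which is why a covector
  field on the base lifts to a vertical field.\<close>

lemma coord_vec_vertical:
  assumes c: "c \<in> A" and d: "d \<in> A" and P: "P \<in> cotangent_bundle A" "fst P \<in> fst c" "fst P \<in> fst d"
  shows "coord_vec (cotangent_atlas A) (cotangent_chart A c) P (0, w) (cotangent_chart A d) =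
    (0, \<chi> i. w \<bullet> coord_vec A d (fst P) (axis i 1) c)"
proof -
  obtain D where D: "((snd (cotangent_chart A d) \<circ> chart_inv (cotangent_chart A c)) has_derivative D)
      (at (snd c (fst P), momentum A c P))"
    "\<And>w. D (0, w) = (0, \<chi> i. w \<bullet> coord_vec A d (fst P) (axis i 1) c)"
    using cotangent_transition_has_derivative[OF c d P(2,3)] by blast
  have "cotangent_chart A d \<in> cotangent_atlas A" "P \<in> fst (cotangent_chart A d)"
    using d P by (auto simp: cotangent_atlas_def fst_cotangent_chart)
  then show ?thesis
    using frechet_derivative_at[OF D(1)] D(2) by (simp add: coord_vec_def snd_cotangent_chart)
qed

end

section \<open>Vertical vector fields\<close>

lemma linear_eq_inner_vec:
  fixes f :: "real^'n \<Rightarrow> real"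
  assumes "linear f"
  shows "f v = (\<chi> i. f (axis i 1)) \<bullet> v"
proof -
  have "f v = f (\<Sum>i\<in>UNIV. v $ i *\<^sub>R axis i 1)"
    using basis_expansion[of v] by (simp add: scalar_mult_eq_scaleR)
  then show ?thesis
    by (simp add: linear_sum[OF assms] linear_scale[OF assms] inner_vec_def mult.commute)
qed

context smooth_manifold
begin

text \<open>A function localised in a coordinate ball is pulled back and extended by zero. The set
  \<open>K\<close> over the closed ball is compact, hence closed in a Hausdorff space. So the domain
  of \<open>c\<close> and the complement of \<open>K\<close> are open and cover the manifold, and
  the extension is smooth on each.\<close>

lemma smooth_function_supported_in_chart:
  assumes c: "c \<in> A" and x: "x \<in> fst c"
  obtains F :: "'m \<Rightarrow> real" where
    "\<And>d. d \<in> A \<Longrightarrow> smooth_on (snd d ` fst d) (F \<circ> chart_inv d)"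
    "frechet_derivative (F \<circ> chart_inv c) (at (snd c x)) = (\<lambda>v. k \<bullet> v)"
proof -
  have opc: "open (snd c ` fst c)" and hom: "homeomorphism (fst c) (snd c ` fst c) (snd c) (chart_inv c)"
    and openA: "\<And>d. d \<in> A \<Longrightarrow> open (fst d)"
    using atlas c unfolding smooth_atlas_def by blast+
  obtain r where r: "r > 0" "cball (snd c x) r \<subseteq> snd c ` fst c"
    using opc x open_contains_cball by (metis imageI)
  obtain B :: "real^'n \<Rightarrow> real" where B: "smooth_on UNIV B"
    "\<And>y. y \<notin> ball (snd c x) r \<Longrightarrow> B y = 0"
    "(B has_derivative (\<lambda>v. k \<bullet> v)) (at (snd c x))"
    by (rule smooth_function_in_ball[OF r(1)]) blast
  define K where "K = chart_inv c ` cball (snd c x) r"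
  have "continuous_on (cball (snd c x) r) (chart_inv c)"
    using hom r(2) by (meson continuous_on_subset homeomorphism_def)
  then have "closed K"
    unfolding K_def by (intro compact_imp_closed compact_continuous_image) auto
  have Kc: "K \<subseteq> fst c"
    unfolding K_def using r(2) by (auto intro: inv_into_into)
  define F where "F = (\<lambda>y. if y \<in> fst c then B (snd c y) else 0)"
  have F0: "F y = 0" if "y \<notin> K" for y
  proof (cases "y \<in> fst c")
    case True
    have "snd c y \<notin> cball (snd c x) r"
      using that True chart_inv_chart[OF c True] unfolding K_def by (metis imageI)
    then have "snd c y \<notin> ball (snd c x) r" by auto
    then show ?thesis using B(2) by (simp add: F_def)
  qed (simp add: F_def)
  show thesis
  proof
    fix d assume d: "d \<in> A"
    have op: "open (snd d ` fst d)" using atlas d unfolding smooth_atlas_def by blast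
    show "smooth_on (snd d ` fst d) (F \<circ> chart_inv d)"
    proof (rule smooth_on_locally[OF op])
      fix q assume "q \<in> snd d ` fst d"
      then obtain y where y: "y \<in> fst d" "q = snd d y" by blast
      show "\<exists>U. open U \<and> q \<in> U \<and> U \<subseteq> snd d ` fst d \<and> smooth_on U (F \<circ> chart_inv d)"
      proof (cases "y \<in> fst c")
        case True
        let ?U = "snd d ` (fst d \<inter> fst c)"
        have U: "open ?U" using open_overlap d c by blast
        have "smooth_on ?U (snd c \<circ> chart_inv d)"
          using atlas c d unfolding smooth_atlas_def by blast
        then have "smooth_on ?U (\<lambda>z. B ((snd c \<circ> chart_inv d) z))"
          by (rule smooth_on_compose[OF unique_diff_set_open[OF U] B(1)]) simp
        then have "smooth_on ?U (F \<circ> chart_inv d)"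
          by (rule smooth_on_cong) (use d in \<open>auto simp: F_def\<close>)
        then show ?thesis using U True y by blast
      next
        case False
        let ?U = "snd d ` (fst d \<inter> - K)"
        have U: "open ?U"
          using open_chart_image_Int[OF atlas d] \<open>closed K\<close> by blast
        have "smooth_on ?U (F \<circ> chart_inv d)"
          by (rule smooth_on_cong[OF smooth_on_const[OF unique_diff_set_open[OF U], of 0]])
            (use d F0 in auto)
        then show ?thesis using U False y Kc by blast
      qed
    qed
  next
    have "((F \<circ> chart_inv c) has_derivative (\<lambda>v. k \<bullet> v)) (at (snd c x))"
      by (rule has_derivative_transform_within_open[OF B(3) opc])
        (use c x in \<open>auto simp: F_def\<close>)
    then show "frechet_derivative (F \<circ> chart_inv c) (at (snd c x)) = (\<lambda>v. k \<bullet> v)"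
      using frechet_derivative_at by metis
  qed
qed

text \<open>The field is the vertical lift of the differential of a function \<open>F\<close> whose
  gradient at the base point is \<open>k\<close>. Its fibre components in each chart are the partial
  derivatives of \<open>F\<close>, so they depend on positions only.\<close>

lemma vertical_vector_field:
  assumes c: "c \<in> A" and P: "P \<in> cotangent_bundle A" "fst P \<in> fst c"
  obtains X where "smooth_vector_field (cotangent_atlas A) X"
    "X P = coord_vec (cotangent_atlas A) (cotangent_chart A c) P (0, k)"
proof -
  obtain F :: "'m \<Rightarrow> real" where F: "\<And>d. d \<in> A \<Longrightarrow> smooth_on (snd d ` fst d) (F \<circ> chart_inv d)"
    and Fc: "frechet_derivative (F \<circ> chart_inv c) (at (snd c (fst P))) = (\<lambda>v. k \<bullet> v)"
    by (rule smooth_function_supported_in_chart[OF c P(2), where k = k]) blast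
  let ?D = "\<lambda>d y. frechet_derivative (F \<circ> chart_inv d) (at (snd d y))"
  define w :: "('m, real^'n) chart \<Rightarrow> 'm \<Rightarrow> real^'n" where
    "w = (\<lambda>d y. \<chi> i. ?D d y (axis i 1))"
  have FD: "((F \<circ> chart_inv d) has_derivative ?D d y) (at (snd d y))" if "d \<in> A" "y \<in> fst d" for d y
  proof -
    have dy: "snd d y \<in> snd d ` fst d" and op: "open (snd d ` fst d)"
      using that open_overlap[of d d] by auto
    have "(F \<circ> chart_inv d) differentiable (at (snd d y))"
      using smooth_on_imp_differentiable_on[OF F[OF that(1)]] at_within_open[OF dy op] dy
      by (metis differentiable_on_def)
    then show ?thesis using frechet_derivative_works by blast
  qed
  \<comment> \<open>The chain rule for \<open>F\<close> through the transition from \<open>e\<close>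
    to \<open>d\<close>; this is the rule that \<open>coord_vec_vertical\<close> demands.\<close>
  have w_change: "w e y = (\<chi> i. w d y \<bullet> coord_vec A e y (axis i 1) d)"
    if "d \<in> A" "e \<in> A" "y \<in> fst d" "y \<in> fst e" for d e y
  proof -
    let ?T = "frechet_derivative (snd d \<circ> chart_inv e) (at (snd e y))"
    have T: "((snd d \<circ> chart_inv e) has_derivative ?T) (at (snd e y))"
      using transition_has_derivative that by blast
    have "((F \<circ> chart_inv d) has_derivative ?D d y) (at ((snd d \<circ> chart_inv e) (snd e y)))"
      using FD[of d y] that by simp
    from diff_chain_at[OF T this]
    have "((F \<circ> chart_inv d) \<circ> (snd d \<circ> chart_inv e) has_derivative ?D d y \<circ> ?T) (at (snd e y))" .
    then have "((F \<circ> chart_inv e) has_derivative ?D d y \<circ> ?T) (at (snd e y))"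
      by (rule has_derivative_transform_within_open[OF _ open_overlap[OF that(2,1)]])
        (use that in auto)
    then have "?D e y = ?D d y \<circ> ?T"
      using frechet_derivative_at by metis
    moreover have "?D d y v = w d y \<bullet> v" for v
      unfolding w_def using linear_eq_inner_vec FD[OF that(1,3)] has_derivative_linear by blast
    moreover have "w e y $ i = ?D e y (axis i 1)" for i by (simp add: w_def)
    ultimately show ?thesis
      using that by (simp add: coord_vec_def vec_eq_iff)
  qed
  let ?A = "cotangent_atlas A" and ?i = "inv_into A (cotangent_chart A)"
  \<comment> \<open>The base chart is recovered as \<open>?i C\<close>. Charts not around
    \<open>Q\<close> get zero, the normal form of tangent vectors.\<close>
  define X :: "'m \<times> ('m, real^'n) covec \<Rightarrow> ('m, 'n) ctvec" where
    "X = (\<lambda>Q C. if C \<in> ?A \<and> Q \<in> fst C then (0, w (?i C) (fst Q)) else 0)"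
  have inv: "?i (cotangent_chart A d) = d" if "d \<in> A" for d
    using inj_on_cotangent_chart that by simp
  have X: "X Q = coord_vec ?A (cotangent_chart A d) Q (0, w d (fst Q))"
    if d: "d \<in> A" and Q: "Q \<in> cotangent_bundle A" "fst Q \<in> fst d" for d Q
  proof
    fix C
    show "X Q C = coord_vec ?A (cotangent_chart A d) Q (0, w d (fst Q)) C"
    proof (cases "C \<in> ?A \<and> Q \<in> fst C")
      case True
      then obtain e where e: "e \<in> A" "C = cotangent_chart A e" "fst Q \<in> fst e"
        by (auto simp: cotangent_atlas_def fst_cotangent_chart)
      then have "X Q C = (0, w e (fst Q))" using True by (simp add: X_def inv)
      also have "\<dots> = coord_vec ?A (cotangent_chart A d) Q (0, w d (fst Q)) C"
        unfolding e(2) coord_vec_vertical[OF d e(1) Q e(3)] using w_change[OF d e(1) Q(2) e(3)] by simp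
      finally show ?thesis .
    next
      case False
      then show ?thesis by (auto simp: X_def coord_vec_def)
    qed
  qed
  have chart: "cotangent_chart A d \<in> ?A" if "d \<in> A" for d
    using that by (simp add: cotangent_atlas_def)
  show thesis
  proof
    show "smooth_vector_field ?A X"
      unfolding smooth_vector_field_def
    proof (intro conjI ballI)
      fix Q assume "Q \<in> (\<Union>C\<in>?A. fst C)"
      then obtain d where d: "d \<in> A" "Q \<in> fst (cotangent_chart A d)" by (auto simp: cotangent_atlas_def)
      then have "Q \<in> cotangent_bundle A" "fst Q \<in> fst d" by (auto simp: fst_cotangent_chart)
      from X[OF d(1) this] show "X Q \<in> tangent_space ?A Q"
        using cot.coord_vec_in_tangent_space[OF chart[OF d(1)] d(2)] by simp
    next
      fix C assume "C \<in> ?A"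
      then obtain d where d: "d \<in> A" "C = cotangent_chart A d" by (auto simp: cotangent_atlas_def)
      have im: "snd C ` fst C = snd d ` fst d \<times> UNIV"
        using cotangent_chart_image[OF d(1) d(1)] d(2) by simp
      have op: "open (snd d ` fst d)" using open_overlap[of d d] d by simp
      then have U: "unique_diff_set (snd d ` fst d \<times> (UNIV :: (real^'n) set))"
        by (intro unique_diff_set_open open_Times open_UNIV)
      let ?h = "\<lambda>i q. frechet_derivative (F \<circ> chart_inv d) (at q within snd d ` fst d) (axis i 1)"
      have "smooth_on (snd d ` fst d \<times> UNIV)
          (\<lambda>z::(real^'n) \<times> (real^'n). \<Sum>i\<in>UNIV. ?h i (fst z) *\<^sub>R (0 :: real^'n, axis i 1 :: real^'n))"
      proof (intro smooth_on_sum smooth_on_scaleR U smooth_on_const)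
        fix i :: 'n
        show "smooth_on (snd d ` fst d \<times> UNIV) (\<lambda>z::(real^'n) \<times> (real^'n). ?h i (fst z))"
          by (rule smooth_on_compose[OF U smooth_on_directional_derivative[OF F[OF d(1)]]
                smooth_on_bounded_linear[OF U bounded_linear_fst]]) auto
      qed
      then show "smooth_on (snd C ` fst C) (\<lambda>z. X (chart_inv C z) C)"
        unfolding im
      proof (rule smooth_on_cong)
        fix z assume "z \<in> snd d ` fst d \<times> (UNIV :: (real^'n) set)"
        then obtain p where z: "fst z \<in> snd d ` fst d" "z = (fst z, p)"
          by (metis mem_Times_iff prod.collapse)
        let ?y = "chart_inv d (fst z)"
        have y: "?y \<in> fst d" "snd d ?y = fst z"
          using z(1) by (auto intro: inv_into_into f_inv_into_f)
        have "chart_inv C z = (?y, covector_of A d ?y p)"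
          using cotangent_chart_inv[OF d(1) z(1), of p] z(2) d(2) by simp
        moreover have "(?y, covector_of A d ?y p) \<in> fst C"
          using d y by (simp add: in_cotangent_chart_iff covector_of_in_cotangent_space)
        ultimately have "X (chart_inv C z) C = (0, w d ?y)"
          using d chart inv by (simp add: X_def)
        moreover have "(\<Sum>i\<in>UNIV. ?h i (fst z) *\<^sub>R (0 :: real^'n, axis i 1 :: real^'n)) = (0, w d ?y)"
          using basis_expansion[of "w d ?y"]
          by (simp add: prod_eq_iff fst_sum snd_sum scalar_mult_eq_scaleR at_within_open[OF z(1) op] y w_def)
        ultimately show "(\<Sum>i\<in>UNIV. ?h i (fst z) *\<^sub>R (0 :: real^'n, axis i 1 :: real^'n)) = X (chart_inv C z) C"
          by simp
      qed
    qed
    have "w c (fst P) = k" by (simp add: w_def Fc inner_axis vec_eq_iff)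
    then show "X P = coord_vec ?A (cotangent_chart A c) P (0, k)"
      using X[OF c P] by simp
  qed
qed

end

section \<open>Linear algebra in a fibre\<close>

text \<open>\<open>J\<close> and \<open>G\<close> are linear only on a tangent space inside a larger
  type, so partial sums must be kept in \<open>T\<close>.\<close>

lemma linear_on_subspace_sum:
  fixes f :: "'v::real_vector \<Rightarrow> 'w::real_vector"
  assumes T: "subspace T" and f: "\<And>v w r. v \<in> T \<Longrightarrow> w \<in> T \<Longrightarrow> f (r *\<^sub>R v + w) = r *\<^sub>R f v + f w"
    and x: "\<And>i. i \<in> I \<Longrightarrow> x i \<in> T"
  shows "f (\<Sum>i\<in>I. a i *\<^sub>R x i) = (\<Sum>i\<in>I. a i *\<^sub>R f (x i))"
proof -
  have "f 0 = f 0 + f 0" using f[OF subspace_0[OF T] subspace_0[OF T], of 1] by simp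
  then have f0: "f 0 = 0" by simp
  show ?thesis
    using x
  proof (induction I rule: infinite_finite_induct)
    case (insert i I)
    have "(\<Sum>i\<in>I. a i *\<^sub>R x i) \<in> T"
      using insert.prems T by (intro subspace_sum subspace_scale) auto
    then show ?case using insert f by simp
  qed (simp_all add: f0)
qed

lemma bilinear_on_subspace_sum:
  fixes B :: "'v::real_vector \<Rightarrow> 'v \<Rightarrow> real"
  assumes T: "subspace T"
    and B: "\<And>u v w r. u \<in> T \<Longrightarrow> v \<in> T \<Longrightarrow> w \<in> T \<Longrightarrow> B (r *\<^sub>R u + v) w = r * B u w + B v w"
    and sym: "\<And>v w. v \<in> T \<Longrightarrow> w \<in> T \<Longrightarrow> B v w = B w v"
    and x: "\<And>i. i \<in> I \<Longrightarrow> x i \<in> T" and y: "\<And>j. j \<in> L \<Longrightarrow> y j \<in> T"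
  shows "B (\<Sum>i\<in>I. a i *\<^sub>R x i) (\<Sum>j\<in>L. b j *\<^sub>R y j) = (\<Sum>i\<in>I. \<Sum>j\<in>L. a i * b j * B (x i) (y j))"
proof -
  let ?x = "\<Sum>i\<in>I. a i *\<^sub>R x i" and ?y = "\<Sum>j\<in>L. b j *\<^sub>R y j"
  have X: "?x \<in> T" and Y: "?y \<in> T"
    using T x y by (auto intro!: subspace_sum subspace_scale)
  \<comment> \<open>Linearity in the second argument comes from symmetry.\<close>
  have "B (x i) ?y = (\<Sum>j\<in>L. b j * B (x i) (y j))" if "i \<in> I" for i
    using linear_on_subspace_sum[OF T, of "\<lambda>v. B v (x i)" L y b] B x[OF that] y
      sym[OF x[OF that] Y] sym[OF x[OF that] y] by simp
  moreover have "B ?x ?y = (\<Sum>i\<in>I. a i * B (x i) ?y)"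
    using linear_on_subspace_sum[OF T, of "\<lambda>v. B v ?y" I x a] B x Y by simp
  ultimately show ?thesis
    by (simp add: sum_distrib_left mult.assoc)
qed

section \<open>Positive definite matrices and scalar identities\<close>

locale positive_matrix =
  fixes K :: "real^'n^'n"
  assumes symmetric: "K $ i $ j = K $ j $ i"
    and positive: "v \<noteq> 0 \<Longrightarrow> v \<bullet> (K *v v) > 0"
begin

lemma transpose_eq: "transpose K = K"
  by (simp add: transpose_def vec_eq_iff symmetric)

lemma invertible: "invertible K"
proof -
  have "x = 0" if "K *v x = 0" for x
    using positive[of x] that by (cases "x = 0") simp_all
  then show ?thesis
    by (simp add: invertible_left_inverse matrix_left_invertible_ker)
qed

lemma matrix_inv_right: "K ** matrix_inv K = mat 1"
  and matrix_inv_left: "matrix_inv K ** K = mat 1"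
proof -
  have "K ** matrix_inv K = mat 1 \<and> matrix_inv K ** K = mat 1"
    unfolding matrix_inv_def by (rule someI_ex) (use invertible in \<open>simp add: invertible_def\<close>)
  then show "K ** matrix_inv K = mat 1" "matrix_inv K ** K = mat 1" by auto
qed

text \<open>Transposing \<open>K ** matrix_inv K = mat 1\<close> gives symmetry. For
  \<open>v = K *v u\<close> the quadratic form of the inverse at \<open>v\<close> is that of
  \<open>K\<close> at \<open>u\<close>.\<close>

lemma positive_matrix_inv: "positive_matrix (matrix_inv K)"
proof
  have "transpose (matrix_inv K) ** K = mat 1"
    using arg_cong[OF matrix_inv_right, of transpose]
    by (simp add: matrix_transpose_mul transpose_eq transpose_mat)
  then have "transpose (matrix_inv K) ** (K ** matrix_inv K) = matrix_inv K"
    by (simp add: matrix_mul_assoc)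
  then have "transpose (matrix_inv K) = matrix_inv K"
    by (simp add: matrix_inv_right)
  then have "transpose (matrix_inv K) $ i $ j = matrix_inv K $ i $ j" for i j
    by simp
  then show "matrix_inv K $ i $ j = matrix_inv K $ j $ i" for i j
    unfolding transpose_def by simp
  show "v \<bullet> (matrix_inv K *v v) > 0" if "v \<noteq> 0" for v
  proof -
    let ?u = "matrix_inv K *v v"
    have Ku: "K *v ?u = v" by (simp add: matrix_vector_mul_assoc matrix_inv_right)
    then have "?u \<noteq> 0" using that by force
    then show ?thesis using positive[of ?u] Ku by (simp add: inner_commute)
  qed
qed

end

lemma row_combination:
  fixes M :: "real^'n^'n" and v :: "real^'n"
  assumes "positive_matrix M"
  shows "(\<chi> j. \<Sum>i\<in>UNIV. v $ i * (a * M $ i $ j + b * q $ i * q $ j)) = a *\<^sub>R (M *v v) + (b * (q \<bullet> v)) *\<^sub>R q"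
proof -
  interpret positive_matrix M by fact
  have "(\<Sum>i\<in>UNIV. v $ i * (a * M $ i $ j + b * q $ i * q $ j)) = a * (M *v v) $ j + b * (q \<bullet> v) * q $ j" for j
    by (simp add: matrix_vector_mult_def inner_vec_def distrib_left sum.distrib sum_distrib_left
        sum_distrib_right symmetric[of _ j] mult_ac)
  then show ?thesis by (simp add: vec_eq_iff)
qed

lemma double_sum:
  fixes M :: "real^'n^'n" and v :: "real^'n"
  shows "(\<Sum>i\<in>UNIV. \<Sum>j\<in>UNIV. v $ i * w $ j * (a * M $ i $ j + b * q $ i * q $ j)) =
    a * (v \<bullet> (M *v w)) + b * (q \<bullet> v) * (q \<bullet> w)"
proof -
  have "(\<Sum>i\<in>UNIV. \<Sum>j\<in>UNIV. v $ i * w $ j * (b * q $ i * q $ j)) = b * (q \<bullet> v) * (q \<bullet> w)"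
    by (simp add: inner_vec_def sum_distrib_left sum_distrib_right sum_product mult_ac)
  moreover have "(\<Sum>i\<in>UNIV. \<Sum>j\<in>UNIV. v $ i * w $ j * (a * M $ i $ j)) = a * (v \<bullet> (M *v w))"
    by (simp add: inner_vec_def matrix_vector_mult_def sum_distrib_left mult_ac)
  ultimately show ?thesis
    by (simp add: distrib_left sum.distrib)
qed

text \<open>Here \<open>s\<close> stands for \<open>2t\<close>. Subtracting the first hypothesis
  from the second leaves \<open>s\<close> times the claim. This turns a condition in the direction
  of the momentum into one on the coefficient of the rank-one term.\<close>

lemma scalar_identity:
  fixes a b c d c' d' s :: real
  assumes "c * a\<^sup>2 = c'" "(c + s * d) * (a + s * b)\<^sup>2 = c' + s * d'" "s \<noteq> 0"
  shows "c * (2 * a * b + s * b\<^sup>2) + d * (a + s * b)\<^sup>2 = d'"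
proof -
  have "s * (c * (2 * a * b + s * b\<^sup>2) + d * (a + s * b)\<^sup>2) =
      (c + s * d) * (a + s * b)\<^sup>2 - c * a\<^sup>2"
    by (simp add: algebra_simps power2_eq_square)
  also have "\<dots> = s * d'" using assms by simp
  finally show ?thesis using assms(3) by simp
qed

text \<open>Pointwise data at a covector with momentum \<open>p\<close>: the adapted frame is \<open>D\<close>, \<open>E\<close>, and
  \<open>r\<close> is the raised momentum, so that \<open>p \<bullet> r = 2t\<close>. Exchanging \<open>(K, p)\<close> with \<open>(K', r)\<close> exchanges
  the horizontal and the vertical half of the statements.\<close>

locale diagonal_fibre =
  fixes T :: "'v::real_vector set" and D E :: "'n::finite \<Rightarrow> 'v"
    and J :: "'v \<Rightarrow> 'v" and G :: "'v \<Rightarrow> 'v \<Rightarrow> real"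
    and K K' :: "real^'n^'n" and p r :: "real^'n"
    and a1 a2 b1 b2 c1 c2 d1 d2 :: real
  assumes T: "subspace T" and DT: "D i \<in> T" and ET: "E i \<in> T"
    and span: "v \<in> T \<Longrightarrow> \<exists>\<alpha> \<beta>. v = (\<Sum>i\<in>UNIV. \<alpha> i *\<^sub>R D i) + (\<Sum>i\<in>UNIV. \<beta> i *\<^sub>R E i)"
    and J_linear: "v \<in> T \<Longrightarrow> w \<in> T \<Longrightarrow> J (s *\<^sub>R v + w) = s *\<^sub>R J v + J w"
    and G_linear: "u \<in> T \<Longrightarrow> v \<in> T \<Longrightarrow> w \<in> T \<Longrightarrow> G (s *\<^sub>R u + v) w = s * G u w + G v w"
    and G_sym: "v \<in> T \<Longrightarrow> w \<in> T \<Longrightarrow> G v w = G w v"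
    and K: "positive_matrix K" and K': "K' = matrix_inv K" and r: "r = K' *v p"
    and JD: "J (D i) = (\<Sum>j\<in>UNIV. (a1 * K $ i $ j + b1 * p $ i * p $ j) *\<^sub>R E j)"
    and JE: "J (E i) = - (\<Sum>j\<in>UNIV. (a2 * K' $ i $ j + b2 * r $ i * r $ j) *\<^sub>R D j)"
    and GDD: "G (D i) (D j) = c1 * K $ i $ j + d1 * p $ i * p $ j"
    and GEE: "G (E i) (E j) = c2 * K' $ i $ j + d2 * r $ i * r $ j"
    and GED: "G (E i) (D j) = 0"
begin

definition H :: "real^'n \<Rightarrow> 'v" where "H \<alpha> = (\<Sum>i\<in>UNIV. \<alpha> $ i *\<^sub>R D i)"
definition V :: "real^'n \<Rightarrow> 'v" where "V \<beta> = (\<Sum>i\<in>UNIV. \<beta> $ i *\<^sub>R E i)"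

lemma HT: "H \<alpha> \<in> T" and VT: "V \<beta> \<in> T"
  unfolding H_def V_def using T DT ET by (auto intro!: subspace_sum subspace_scale)

lemma minus_T: "v \<in> T \<Longrightarrow> - v \<in> T"
  using subspace_neg[OF T] .

lemma add_T: "v \<in> T \<Longrightarrow> w \<in> T \<Longrightarrow> v + w \<in> T"
  using subspace_add[OF T] .

lemma obtain_HV:
  assumes "v \<in> T"
  obtains \<alpha> \<beta> where "v = H \<alpha> + V \<beta>"
proof -
  obtain \<alpha> \<beta> where "v = (\<Sum>i\<in>UNIV. \<alpha> i *\<^sub>R D i) + (\<Sum>i\<in>UNIV. \<beta> i *\<^sub>R E i)"
    using span[OF assms] by blast
  then have "v = H (\<chi> i. \<alpha> i) + V (\<chi> i. \<beta> i)" by (simp add: H_def V_def)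
  then show thesis by (rule that)
qed

sublocale K: positive_matrix K by (rule K)
sublocale K': positive_matrix K' unfolding K' by (rule K.positive_matrix_inv)

lemma K_K': "K *v (K' *v v) = v" and K'_K: "K' *v (K *v v) = v"
  by (simp_all add: K' matrix_vector_mul_assoc K.matrix_inv_right K.matrix_inv_left)

lemma Kr: "K *v r = p"
  by (simp add: r K_K')

lemma inner_K: "u \<bullet> (K *v v) = (K *v u) \<bullet> v" and inner_K': "u \<bullet> (K' *v v) = (K' *v u) \<bullet> v"
  using dot_lmul_matrix[of u K v] dot_lmul_matrix[of u K' v]
    transpose_matrix_vector[of K u] transpose_matrix_vector[of K' u]
  by (simp_all add: K.transpose_eq K'.transpose_eq)

section \<open>\<open>J\<close> and \<open>G\<close> on horizontal and vertical vectors\<close>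

lemma J_H: "J (H \<alpha>) = V (a1 *\<^sub>R (K *v \<alpha>) + (b1 * (p \<bullet> \<alpha>)) *\<^sub>R p)"
proof -
  have "J (H \<alpha>) = (\<Sum>i\<in>UNIV. \<alpha> $ i *\<^sub>R J (D i))"
    unfolding H_def by (rule linear_on_subspace_sum[OF T J_linear DT])
  also have "\<dots> = (\<Sum>j\<in>UNIV. \<Sum>i\<in>UNIV. (\<alpha> $ i * (a1 * K $ i $ j + b1 * p $ i * p $ j)) *\<^sub>R E j)"
    by (subst sum.swap) (simp add: JD scaleR_sum_right)
  also have "\<dots> = V (\<chi> j. \<Sum>i\<in>UNIV. \<alpha> $ i * (a1 * K $ i $ j + b1 * p $ i * p $ j))"
    by (simp add: V_def scaleR_sum_left)
  finally show ?thesis by (simp add: row_combination[OF K])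
qed

lemma J_V: "J (V \<beta>) = - H (a2 *\<^sub>R (K' *v \<beta>) + (b2 * (r \<bullet> \<beta>)) *\<^sub>R r)"
proof -
  have "J (V \<beta>) = (\<Sum>i\<in>UNIV. \<beta> $ i *\<^sub>R J (E i))"
    unfolding V_def by (rule linear_on_subspace_sum[OF T J_linear ET])
  also have "\<dots> = - (\<Sum>j\<in>UNIV. \<Sum>i\<in>UNIV. (\<beta> $ i * (a2 * K' $ i $ j + b2 * r $ i * r $ j)) *\<^sub>R D j)"
    by (subst sum.swap) (simp add: JE scaleR_sum_right sum_negf)
  also have "\<dots> = - H (\<chi> j. \<Sum>i\<in>UNIV. \<beta> $ i * (a2 * K' $ i $ j + b2 * r $ i * r $ j))"
    by (simp add: H_def scaleR_sum_left)
  finally show ?thesis by (simp add: row_combination[OF K'.positive_matrix_axioms])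
qed

lemma G_HH: "G (H \<alpha>) (H \<alpha>') = c1 * (\<alpha> \<bullet> (K *v \<alpha>')) + d1 * (p \<bullet> \<alpha>) * (p \<bullet> \<alpha>')"
proof -
  have "G (H \<alpha>) (H \<alpha>') = (\<Sum>i\<in>UNIV. \<Sum>j\<in>UNIV. \<alpha> $ i * \<alpha>' $ j * G (D i) (D j))"
    unfolding H_def by (rule bilinear_on_subspace_sum[OF T G_linear G_sym DT DT])
  then show ?thesis by (simp add: GDD double_sum)
qed

lemma G_VV: "G (V \<beta>) (V \<beta>') = c2 * (\<beta> \<bullet> (K' *v \<beta>')) + d2 * (r \<bullet> \<beta>) * (r \<bullet> \<beta>')"
proof -
  have "G (V \<beta>) (V \<beta>') = (\<Sum>i\<in>UNIV. \<Sum>j\<in>UNIV. \<beta> $ i * \<beta>' $ j * G (E i) (E j))"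
    unfolding V_def by (rule bilinear_on_subspace_sum[OF T G_linear G_sym ET ET])
  then show ?thesis by (simp add: GEE double_sum)
qed

lemma G_VH: "G (V \<beta>) (H \<alpha>) = 0" and G_HV: "G (H \<alpha>) (V \<beta>) = 0"
proof -
  have "G (V \<beta>) (H \<alpha>) = (\<Sum>i\<in>UNIV. \<Sum>j\<in>UNIV. \<beta> $ i * \<alpha> $ j * G (E i) (D j))"
    unfolding V_def H_def by (rule bilinear_on_subspace_sum[OF T G_linear G_sym ET DT])
  then show "G (V \<beta>) (H \<alpha>) = 0" by (simp add: GED)
  then show "G (H \<alpha>) (V \<beta>) = 0" using G_sym HT VT by metis
qed

lemma G_add: "u \<in> T \<Longrightarrow> v \<in> T \<Longrightarrow> w \<in> T \<Longrightarrow> G (u + v) w = G u w + G v w"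
  using G_linear[of u v w 1] by simp

lemma G_minus: "v \<in> T \<Longrightarrow> w \<in> T \<Longrightarrow> G (- v) w = - G v w"
  using G_linear[of v 0 w "- 1"] G_linear[of 0 0 w 1] subspace_0[OF T] by simp

lemma G_minus_minus: "v \<in> T \<Longrightarrow> w \<in> T \<Longrightarrow> G (- v) (- w) = G v w"
  using G_minus G_sym minus_T by (metis minus_minus)

lemma G_add_add:
  "v \<in> T \<Longrightarrow> v' \<in> T \<Longrightarrow> w \<in> T \<Longrightarrow> w' \<in> T \<Longrightarrow>
     G (v + v') (w + w') = G v w + G v w' + (G v' w + G v' w')"
  using G_add G_sym add_T by metis

lemma J_add: "v \<in> T \<Longrightarrow> w \<in> T \<Longrightarrow> J (v + w) = J v + J w"
  using J_linear[of v w 1] by simp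

text \<open>\<open>J\<close> makes \<open>V \<beta>\<close> horizontal, and there \<open>K\<close>
  undoes \<open>K'\<close> and sends \<open>r\<close> to \<open>p\<close>. The pulled-back form is
  therefore again a multiple of \<open>K'\<close> plus a rank-one term in \<open>r\<close>, ready
  for comparison with \<open>G_VV\<close>.\<close>

lemma G_J_V:
  "G (J (V \<beta>)) (J (V \<beta>')) = c1 * a2\<^sup>2 * (\<beta> \<bullet> (K' *v \<beta>')) +
     (c1 * (2 * a2 * b2 + (p \<bullet> r) * b2\<^sup>2) + d1 * (a2 + (p \<bullet> r) * b2)\<^sup>2) * (r \<bullet> \<beta>) * (r \<bullet> \<beta>')"
proof -
  let ?B = "\<lambda>\<beta>. a2 *\<^sub>R (K' *v \<beta>) + (b2 * (r \<bullet> \<beta>)) *\<^sub>R r"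
  have KB: "K *v ?B \<beta> = a2 *\<^sub>R \<beta> + (b2 * (r \<bullet> \<beta>)) *\<^sub>R p" for \<beta>
    by (simp add: matrix_vector_right_distrib matrix_vector_mult_scaleR K_K' Kr)
  have pK: "p \<bullet> (K' *v \<beta>) = r \<bullet> \<beta>" for \<beta> by (simp add: inner_K' r)
  have "G (J (V \<beta>)) (J (V \<beta>')) = G (H (?B \<beta>)) (H (?B \<beta>'))"
    by (simp add: J_V G_minus_minus HT)
  also have "\<dots> = c1 * (?B \<beta> \<bullet> (a2 *\<^sub>R \<beta>' + (b2 * (r \<bullet> \<beta>')) *\<^sub>R p)) + d1 * (p \<bullet> ?B \<beta>) * (p \<bullet> ?B \<beta>')"
    by (simp only: G_HH KB)
  also have "\<dots> = c1 * a2\<^sup>2 * ((K' *v \<beta>) \<bullet> \<beta>') +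
     (c1 * (2 * a2 * b2 + (p \<bullet> r) * b2\<^sup>2) + d1 * (a2 + (p \<bullet> r) * b2)\<^sup>2) * (r \<bullet> \<beta>) * (r \<bullet> \<beta>')"
    by (simp add: inner_add_left inner_add_right pK inner_commute[of _ p])
      (simp add: algebra_simps power2_eq_square)
  finally show ?thesis by (simp add: inner_K')
qed

lemma G_J_H:
  "G (J (H \<alpha>)) (J (H \<alpha>')) = c2 * a1\<^sup>2 * (\<alpha> \<bullet> (K *v \<alpha>')) +
     (c2 * (2 * a1 * b1 + (p \<bullet> r) * b1\<^sup>2) + d2 * (a1 + (p \<bullet> r) * b1)\<^sup>2) * (p \<bullet> \<alpha>) * (p \<bullet> \<alpha>')"
proof -
  let ?B = "\<lambda>\<alpha>. a1 *\<^sub>R (K *v \<alpha>) + (b1 * (p \<bullet> \<alpha>)) *\<^sub>R p"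
  have KB: "K' *v ?B \<alpha> = a1 *\<^sub>R \<alpha> + (b1 * (p \<bullet> \<alpha>)) *\<^sub>R r" for \<alpha>
    by (simp add: matrix_vector_right_distrib matrix_vector_mult_scaleR K'_K r)
  have rK: "r \<bullet> (K *v \<alpha>) = p \<bullet> \<alpha>" for \<alpha> by (simp add: inner_K Kr)
  have "G (J (H \<alpha>)) (J (H \<alpha>')) = c2 * (?B \<alpha> \<bullet> (a1 *\<^sub>R \<alpha>' + (b1 * (p \<bullet> \<alpha>')) *\<^sub>R r)) + d2 * (r \<bullet> ?B \<alpha>) * (r \<bullet> ?B \<alpha>')"
    by (simp only: J_H G_VV KB)
  also have "\<dots> = c2 * a1\<^sup>2 * ((K *v \<alpha>) \<bullet> \<alpha>') +
     (c2 * (2 * a1 * b1 + (p \<bullet> r) * b1\<^sup>2) + d2 * (a1 + (p \<bullet> r) * b1)\<^sup>2) * (p \<bullet> \<alpha>) * (p \<bullet> \<alpha>')"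
    by (simp add: inner_add_left inner_add_right rK inner_commute[of _ r])
      (simp add: inner_commute[of r p] algebra_simps power2_eq_square)
  finally show ?thesis by (simp add: inner_K)
qed

lemma norm_p_pos: "p \<noteq> 0 \<Longrightarrow> p \<bullet> r > 0"
  using K'.positive r by simp

section \<open>The Hermitian condition in one fibre\<close>

text \<open>At \<open>p = 0\<close> the rank-one terms vanish; otherwise
  \<open>scalar_identity\<close> with \<open>s = p \<bullet> r\<close> matches their coefficients.
  Mixed terms vanish because \<open>J\<close> exchanges horizontal and vertical vectors, which are
  orthogonal for \<open>G\<close>.\<close>

lemma hermitian_if:
  assumes 1: "c1 * a2\<^sup>2 = c2" "(c1 + (p \<bullet> r) * d1) * (a2 + (p \<bullet> r) * b2)\<^sup>2 = c2 + (p \<bullet> r) * d2"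
    and 2: "c2 * a1\<^sup>2 = c1" "(c2 + (p \<bullet> r) * d2) * (a1 + (p \<bullet> r) * b1)\<^sup>2 = c1 + (p \<bullet> r) * d1"
    and "v \<in> T" "w \<in> T"
  shows "G (J v) (J w) = G v w"
proof -
  have VV: "G (J (V \<beta>)) (J (V \<beta>')) = G (V \<beta>) (V \<beta>')" for \<beta> \<beta>'
  proof (cases "p = 0")
    case True
    then show ?thesis using 1 by (simp add: G_J_V G_VV r)
  next
    case False
    then show ?thesis
      using scalar_identity[OF 1] norm_p_pos 1(1) by (simp add: G_J_V G_VV)
  qed
  have HH: "G (J (H \<alpha>)) (J (H \<alpha>')) = G (H \<alpha>) (H \<alpha>')" for \<alpha> \<alpha>'
  proof (cases "p = 0")
    case True
    then show ?thesis using 2 by (simp add: G_J_H G_HH)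
  next
    case False
    then show ?thesis
      using scalar_identity[OF 2] norm_p_pos 2(1) by (simp add: G_J_H G_HH)
  qed
  have VH: "G (J (V \<beta>)) (J (H \<alpha>)) = 0" for \<alpha> \<beta>
    by (simp add: J_V J_H G_minus HT VT G_HV)
  have JT: "J (V \<beta>) \<in> T" "J (H \<alpha>) \<in> T" for \<alpha> \<beta>
    using HT VT minus_T by (auto simp: J_V J_H)
  then have HV: "G (J (H \<alpha>)) (J (V \<beta>)) = 0" for \<alpha> \<beta>
    using VH G_sym by metis
  obtain \<alpha> \<beta> where v: "v = H \<alpha> + V \<beta>" using obtain_HV assms by blast
  obtain \<alpha>' \<beta>' where w: "w = H \<alpha>' + V \<beta>'" using obtain_HV assms by blast
  show ?thesis
    unfolding v w by (simp add: J_add HT VT G_add_add JT VV HH VH HV G_VH G_HV)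
qed

text \<open>Two test vectors decide. A nonzero \<open>\<beta>\<close> with
  \<open>r \<bullet> \<beta> = 0\<close>, available because the dimension exceeds one, removes the
  rank-one terms and gives the first equation; \<open>p\<close> itself gives the second.\<close>

lemma only_if:
  assumes herm: "\<And>\<beta>. G (J (V \<beta>)) (J (V \<beta>)) = G (V \<beta>) (V \<beta>)"
    and dim: "CARD('n) > 1"
  shows "c1 * a2\<^sup>2 = c2" "(c1 + (p \<bullet> r) * d1) * (a2 + (p \<bullet> r) * b2)\<^sup>2 = c2 + (p \<bullet> r) * d2"
proof -
  obtain i j :: 'n where ij: "i \<noteq> j"
    using dim card_le_Suc0_iff_eq[of "UNIV :: 'n set"] by fastforce
  obtain \<beta> where \<beta>: "\<beta> \<noteq> 0" "r \<bullet> \<beta> = 0"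
  proof (cases "r $ i = 0")
    case True
    then show thesis
      by (intro that[of "axis i 1"]) (auto simp: inner_axis axis_eq_0_iff)
  next
    case False
    \<comment> \<open>Orthogonal to \<open>r\<close> by cancellation, with nonzero
      \<open>j\<close>-th component \<open>- r $ i\<close>.\<close>
    let ?\<beta> = "r $ j *\<^sub>R axis i 1 - r $ i *\<^sub>R axis j (1::real)"
    have "?\<beta> $ j \<noteq> 0" using False ij by (simp add: axis_def)
    then have "?\<beta> \<noteq> 0" by (metis zero_index)
    then show thesis
      by (intro that[of ?\<beta>]) (simp_all add: inner_diff_right inner_axis)
  qed
  show c: "c1 * a2\<^sup>2 = c2"
    using herm[of \<beta>] K'.positive[OF \<beta>(1)] \<beta>(2) by (simp add: G_J_V G_VV)
  show "(c1 + (p \<bullet> r) * d1) * (a2 + (p \<bullet> r) * b2)\<^sup>2 = c2 + (p \<bullet> r) * d2"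
  proof (cases "p = 0")
    case True
    then show ?thesis using c by simp
  next
    case False
    then have s: "p \<bullet> r > 0" by (rule norm_p_pos)
    have pK: "p \<bullet> (K' *v p) = p \<bullet> r" by (simp add: r)
    \<comment> \<open>With \<open>s = p \<bullet> r\<close>, both sides at \<open>p\<close> are
      \<open>s\<close> times a coefficient of \<open>K'\<close> plus \<open>s^2\<close> times a
      rank-one coefficient. The first parts cancel by \<open>c\<close>, and \<open>s^2\<close>
      divides out.\<close>
    have "c1 * (2 * a2 * b2 + (p \<bullet> r) * b2\<^sup>2) + d1 * (a2 + (p \<bullet> r) * b2)\<^sup>2 = d2"
      using herm[of p] s c by (simp add: G_J_V G_VV pK inner_commute[of r p])
    then show ?thesis
      unfolding c[symmetric] by (auto simp: algebra_simps power2_eq_square)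
  qed
qed

end

section \<open>Natural structures of diagonal type\<close>

context smooth_manifold
begin

text \<open>The quadratic form of this Gram matrix at \<open>v\<close> is \<open>g\<close> on the
  tangent vector with components \<open>v\<close> in \<open>c\<close>, which is nonzero whenever
  \<open>v\<close> is.\<close>

lemma positive_metric_matrix:
  assumes g: "riemannian_metric A g" and c: "c \<in> A" "x \<in> fst c"
  shows "positive_matrix (metric_matrix A g c x)"
proof -
  let ?T = "tangent_space A x" and ?L = "coord_vec A c x" and ?K = "metric_matrix A g c x"
  have x: "x \<in> (\<Union>c\<in>A. fst c)" using c by blast
  have lin: "\<And>u v w r. u \<in> ?T \<Longrightarrow> v \<in> ?T \<Longrightarrow> w \<in> ?T \<Longrightarrow> g x (r *\<^sub>R u + v) w = r * g x u w + g x v w"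
    and sym: "\<And>u v. u \<in> ?T \<Longrightarrow> v \<in> ?T \<Longrightarrow> g x u v = g x v u"
    and pos: "\<And>v. v \<in> ?T \<Longrightarrow> v \<noteq> 0 \<Longrightarrow> g x v v > 0"
    using bspec[OF conjunct1[OF g[unfolded riemannian_metric_def]] x] by simp_all
  have LT: "?L u \<in> ?T" for u by (rule coord_vec_in_tangent_space[OF c])
  have L: "linear ?L" by (rule linear_coord_vec[OF c])
  have quad: "v \<bullet> (?K *v v) = g x (?L v) (?L v)" for v
  proof -
    have "?L v = ?L (\<Sum>i\<in>UNIV. v $ i *\<^sub>R axis i 1)"
      using basis_expansion[of v] by (simp add: scalar_mult_eq_scaleR)
    then have v: "?L v = (\<Sum>i\<in>UNIV. v $ i *\<^sub>R ?L (axis i 1))"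
      by (simp add: linear_sum[OF L] linear_scale[OF L])
    have "g x (?L v) (?L v) =
        (\<Sum>i\<in>UNIV. \<Sum>j\<in>UNIV. v $ i * v $ j * g x (?L (axis i 1)) (?L (axis j 1)))"
      unfolding v by (rule bilinear_on_subspace_sum[OF subspace_tangent_space[OF c] lin sym LT LT])
    then show ?thesis
      by (simp add: inner_vec_def matrix_vector_mult_def sum_distrib_left metric_matrix_def mult_ac)
  qed
  show ?thesis
  proof
    show "?K $ i $ j = ?K $ j $ i" for i j
      using sym LT by (simp add: metric_matrix_def)
    show "v \<bullet> (?K *v v) > 0" if "v \<noteq> 0" for v
    proof -
      have "?L v \<noteq> 0" using coord_vec_self[OF c, of v] that by (metis zero_fun_apply)
      then show ?thesis using quad pos LT by simp
    qed
  qed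
qed

lemma cotangent_chart_in_atlas: "c \<in> A \<Longrightarrow> cotangent_chart A c \<in> cotangent_atlas A"
  by (simp add: cotangent_atlas_def)

lemma UN_cotangent_atlas: "(\<Union>C\<in>cotangent_atlas A. fst C) = cotangent_bundle A"
  by (auto simp: cotangent_atlas_def fst_cotangent_chart cotangent_bundle_def)

section \<open>The adapted frame at a point\<close>

context
  fixes c and P :: "'m \<times> ('m, real^'n) covec"
  assumes c: "c \<in> A" and P: "P \<in> cotangent_bundle A" "fst P \<in> fst c"
begin

abbreviation (input) tangent_vec :: "(real^'n) \<times> (real^'n) \<Rightarrow> ('m, 'n) ctvec" where
  "tangent_vec \<equiv> coord_vec (cotangent_atlas A) (cotangent_chart A c) P"

lemma P_in_chart: "P \<in> fst (cotangent_chart A c)"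
  using P by (simp add: fst_cotangent_chart)

lemmas linear_tangent_vec =
  cot.linear_coord_vec[OF cotangent_chart_in_atlas[OF c] P_in_chart]

lemma sum_frame_p: "(\<Sum>i\<in>UNIV. \<beta> i *\<^sub>R frame_p A c P i) = tangent_vec (0, \<chi> i. \<beta> i)"
proof -
  have "(0, \<chi> i. \<beta> i) = (\<Sum>i\<in>UNIV. \<beta> i *\<^sub>R (0 :: real^'n, axis i 1 :: real^'n))"
    using basis_expansion[of "\<chi> i. \<beta> i"]
    by (simp add: prod_eq_iff fst_sum snd_sum scalar_mult_eq_scaleR)
  then show ?thesis
    by (simp add: frame_p_def linear_sum[OF linear_tangent_vec] flip: linear_scale[OF linear_tangent_vec])
qed

lemma frame_delta_eq: "frame_delta A g c P i = tangent_vec (axis i 1, \<chi> h. christoffel0 A g c P i h)"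
  unfolding frame_delta_def sum_frame_p
  by (simp add: frame_q_def flip: linear_add[OF linear_tangent_vec])

lemma sum_frame_delta:
  "(\<Sum>i\<in>UNIV. \<alpha> i *\<^sub>R frame_delta A g c P i) =
     tangent_vec (\<chi> i. \<alpha> i, \<Sum>i\<in>UNIV. \<alpha> i *\<^sub>R (\<chi> h. christoffel0 A g c P i h))"
proof -
  have "(\<chi> i. \<alpha> i, \<Sum>i\<in>UNIV. \<alpha> i *\<^sub>R (\<chi> h. christoffel0 A g c P i h)) =
      (\<Sum>i\<in>UNIV. \<alpha> i *\<^sub>R (axis i 1 :: real^'n, \<chi> h. christoffel0 A g c P i h))"
    using basis_expansion[of "\<chi> i. \<alpha> i"]
    by (simp add: prod_eq_iff fst_sum snd_sum scalar_mult_eq_scaleR)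
  then show ?thesis
    by (simp add: frame_delta_eq linear_sum[OF linear_tangent_vec] flip: linear_scale[OF linear_tangent_vec])
qed

text \<open>The frame is triangular over the coordinate frame: the position components fix the
  horizontal part, and the Christoffel terms it brings are subtracted from the momentum
  components.\<close>

lemma adapted_frame_spans:
  assumes "v \<in> tangent_space (cotangent_atlas A) P"
  shows "\<exists>\<alpha> \<beta>. v = (\<Sum>i\<in>UNIV. \<alpha> i *\<^sub>R frame_delta A g c P i) + (\<Sum>i\<in>UNIV. \<beta> i *\<^sub>R frame_p A c P i)"
proof -
  obtain u w where v: "v = tangent_vec (u, w)"
    using cot.tangent_space_coord_vec[OF cotangent_chart_in_atlas[OF c] P_in_chart assms]
    by (metis prod.collapse)
  let ?S = "\<Sum>i\<in>UNIV. u $ i *\<^sub>R (\<chi> h. christoffel0 A g c P i h)"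
  define z where "z = w - ?S"
  have "v = tangent_vec (u, ?S) + tangent_vec (0, z)"
    by (simp add: v z_def flip: linear_add[OF linear_tangent_vec])
  then have "v = (\<Sum>i\<in>UNIV. u $ i *\<^sub>R frame_delta A g c P i) + (\<Sum>i\<in>UNIV. z $ i *\<^sub>R frame_p A c P i)"
    unfolding sum_frame_delta sum_frame_p by simp
  then show ?thesis by (intro exI)
qed

lemma raised_momentum_eq:
  assumes "riemannian_metric A g"
  shows "(\<chi> i. raised_momentum A g c P i) = matrix_inv (metric_matrix A g c (fst P)) *v momentum A c P"
proof -
  interpret K: positive_matrix "metric_matrix A g c (fst P)"
    using positive_metric_matrix[OF assms c P(2)] .
  interpret K': positive_matrix "matrix_inv (metric_matrix A g c (fst P))"
    by (rule K.positive_matrix_inv)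
  show ?thesis
    by (simp add: vec_eq_iff raised_momentum_def matrix_vector_mult_def K'.symmetric[of _ i for i] mult.commute)
qed

lemma energy_eq:
  "2 * energy A g c P =
     momentum A c P \<bullet> (matrix_inv (metric_matrix A g c (fst P)) *v momentum A c P)"
  by (simp add: energy_def inner_vec_def matrix_vector_mult_def sum_distrib_left mult_ac)

text \<open>At a fixed point the eight coefficient functions become numbers, their values at the
  energy of \<open>P\<close>, and the Hermitian condition becomes linear algebra.\<close>

lemma diagonal_fibre_adapted_frame:
  assumes g: "riemannian_metric A g"
    and J: "natural_almost_complex A g a1 a2 b1 b2 J"
    and G: "natural_metric A g c1 c2 d1 d2 G"
    and t: "t = energy A g c P"
  shows "diagonal_fibre (tangent_space (cotangent_atlas A) P) (frame_delta A g c P) (frame_p A c P)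
    (J P) (G P) (metric_matrix A g c (fst P)) (matrix_inv (metric_matrix A g c (fst P)))
    (momentum A c P) (\<chi> i. raised_momentum A g c P i)
    (a1 t) (a2 t) (b1 t) (b2 t) (c1 t) (c2 t) (d1 t) (d2 t)"
proof (rule diagonal_fibre.intro)
  note mem = cot.coord_vec_in_tangent_space[OF cotangent_chart_in_atlas[OF c] P_in_chart]
  let ?T = "tangent_space (cotangent_atlas A) P"
  show "subspace ?T"
    by (rule cot.subspace_tangent_space[OF cotangent_chart_in_atlas[OF c] P_in_chart])
  show "frame_delta A g c P i \<in> ?T" "frame_p A c P i \<in> ?T" for i
    by (simp_all add: frame_delta_eq frame_p_def mem)
  show "\<exists>\<alpha> \<beta>. v = (\<Sum>i\<in>UNIV. \<alpha> i *\<^sub>R frame_delta A g c P i) + (\<Sum>i\<in>UNIV. \<beta> i *\<^sub>R frame_p A c P i)"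
    if "v \<in> ?T" for v using adapted_frame_spans[OF that] .
  show "positive_matrix (metric_matrix A g c (fst P))"
    by (rule positive_metric_matrix[OF g c P(2)])
  show "(\<chi> i. raised_momentum A g c P i) = matrix_inv (metric_matrix A g c (fst P)) *v momentum A c P"
    by (rule raised_momentum_eq[OF g])
  show "J P (s *\<^sub>R v + w) = s *\<^sub>R J P v + J P w" if "v \<in> ?T" "w \<in> ?T" for v w s
    using bspec[OF conjunct1[OF J[unfolded natural_almost_complex_def Let_def]] P(1)] that by simp
  show "G P (s *\<^sub>R u + v) w = s * G P u w + G P v w" if "u \<in> ?T" "v \<in> ?T" "w \<in> ?T" for u v w s
    using bspec[OF conjunct1[OF G[unfolded natural_metric_def Let_def]] P(1)] that by simp
  show "G P v w = G P w v" if "v \<in> ?T" "w \<in> ?T" for v w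
    using bspec[OF conjunct1[OF G[unfolded natural_metric_def Let_def]] P(1)] that by simp
qed (use J G c P in \<open>simp_all add: natural_almost_complex_def natural_metric_def Let_def t\<close>)

end

text \<open>Energy is quadratic in the momentum, so multiples of one nonzero covector attain every
  nonnegative value. Pointwise relations thus become identities for all
  \<open>t \<ge> 0\<close>.\<close>

lemma point_with_energy:
  assumes g: "riemannian_metric A g" and t: "t \<ge> 0"
  obtains c P where "c \<in> A" "P \<in> cotangent_bundle A" "fst P \<in> fst c" "energy A g c P = t"
proof -
  \<comment> \<open>Types are inhabited, so an arbitrary point, and below an arbitrary index, will
    serve.\<close>
  fix x :: 'm
  obtain c where c: "c \<in> A" "x \<in> fst c"
    using atlas unfolding smooth_atlas_def by blast
  interpret K: positive_matrix "metric_matrix A g c x"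
    by (rule positive_metric_matrix[OF g c])
  let ?K = "matrix_inv (metric_matrix A g c x)"
  interpret K': positive_matrix ?K by (rule K.positive_matrix_inv)
  fix i :: 'n
  let ?e = "axis i 1 :: real^'n"
  let ?s = "?e \<bullet> (?K *v ?e)"
  have s: "?s > 0" by (rule K'.positive) (simp add: axis_eq_0_iff)
  define p where "p = sqrt (2 * t / ?s) *\<^sub>R ?e"
  have "p \<bullet> (?K *v p) = (sqrt (2 * t / ?s) * sqrt (2 * t / ?s)) * ?s"
    by (simp add: p_def matrix_vector_mult_scaleR mult_ac)
  also have "\<dots> = 2 * t" using s t by simp
  finally have p: "p \<bullet> (?K *v p) = 2 * t" .
  let ?P = "(x, covector_of A c x p)"
  have P: "?P \<in> cotangent_bundle A"
    using c by (auto simp: cotangent_bundle_def covector_of_in_cotangent_space)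
  have "2 * energy A g c ?P = 2 * t"
    using energy_eq[of c ?P g] c P p by (simp add: momentum_covector_of_self)
  then show thesis using that[OF c(1) P] c(2) by simp
qed

end

theorem theorem4:
  fixes A :: "('m::{t2_space, second_countable_topology}, real^'n) chart set"
    and g :: "'m \<Rightarrow> ('m, real^'n) tvec \<Rightarrow> ('m, real^'n) tvec \<Rightarrow> real"
    and a1 a2 b1 b2 c1 c2 d1 d2 :: "real \<Rightarrow> real"
    and J :: "'m \<times> ('m, real^'n) covec \<Rightarrow> ('m, 'n) ctvec \<Rightarrow> ('m, 'n) ctvec"
    and G :: "'m \<times> ('m, real^'n) covec \<Rightarrow> ('m, 'n) ctvec \<Rightarrow> ('m, 'n) ctvec \<Rightarrow> real"
  assumes dim: "CARD('n) > 1"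
    and M: "smooth_atlas A"
    and g: "riemannian_metric A g"
    and smooth_ab: "smooth_on {0..} a1" "smooth_on {0..} a2" "smooth_on {0..} b1" "smooth_on {0..} b2"
    and a1a2: "\<And>t. t \<ge> 0 \<Longrightarrow> a1 t * a2 t = 1"
    and ab: "\<And>t. t \<ge> 0 \<Longrightarrow> (a1 t + 2 * t * b1 t) * (a2 t + 2 * t * b2 t) = 1"
    and pos_ab: "\<And>t. t \<ge> 0 \<Longrightarrow>
      a1 t > 0 \<and> a2 t > 0 \<and> a1 t + 2 * t * b1 t > 0 \<and> a2 t + 2 * t * b2 t > 0"
    and smooth_cd: "smooth_on {0..} c1" "smooth_on {0..} c2" "smooth_on {0..} d1" "smooth_on {0..} d2"
    and pos_cd: "\<And>t. t \<ge> 0 \<Longrightarrow>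
      c1 t > 0 \<and> c2 t > 0 \<and> c1 t + 2 * t * d1 t > 0 \<and> c2 t + 2 * t * d2 t > 0"
    and J: "natural_almost_complex A g a1 a2 b1 b2 J"
    and G: "natural_metric A g c1 c2 d1 d2 G"
  shows "almost_hermitian (cotangent_atlas A) G J \<longleftrightarrow>
    (\<exists>lam mu :: real \<Rightarrow> real.
       smooth_on {0..} lam \<and> smooth_on {0..} mu \<and>
       (\<forall>t\<ge>0. lam t > 0 \<and> lam t + 2 * t * mu t > 0 \<and>
          c1 t = lam t * a1 t \<and>
          c2 t = lam t * a2 t \<and>
          c1 t + 2 * t * d1 t = (lam t + 2 * t * mu t) * (a1 t + 2 * t * b1 t) \<and>
          c2 t + 2 * t * d2 t = (lam t + 2 * t * mu t) * (a2 t + 2 * t * b2 t)))"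
    (is "?herm \<longleftrightarrow> ?conformal")
proof -
  interpret smooth_manifold A by standard (rule M)
  have S: "unique_diff_set {0::real..}" by (rule unique_diff_set_atLeast)
  show ?thesis
  proof
    assume herm: ?herm
    have rel: "c1 t * (a2 t)\<^sup>2 = c2 t \<and>
        (c1 t + 2 * t * d1 t) * (a2 t + 2 * t * b2 t)\<^sup>2 = c2 t + 2 * t * d2 t" if t: "t \<ge> 0" for t
    proof -
      obtain c P where c: "c \<in> A" and P: "P \<in> cotangent_bundle A" "fst P \<in> fst c"
        and en: "energy A g c P = t"
        using point_with_energy[OF g t] by blast
      interpret F: diagonal_fibre "tangent_space (cotangent_atlas A) P" "frame_delta A g c P"
        "frame_p A c P" "J P" "G P" "metric_matrix A g c (fst P)"
        "matrix_inv (metric_matrix A g c (fst P))" "momentum A c P"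
        "\<chi> i. raised_momentum A g c P i" "a1 t" "a2 t" "b1 t" "b2 t" "c1 t" "c2 t" "d1 t" "d2 t"
        by (rule diagonal_fibre_adapted_frame[OF c P g J G en[symmetric]])
      have pr: "momentum A c P \<bullet> (\<chi> i. raised_momentum A g c P i) = 2 * t"
        using energy_eq[OF c P, of g] raised_momentum_eq[OF c P g] en by simp
      \<comment> \<open>\<open>almost_hermitian\<close> quantifies over smooth fields; a field
        extending the vertical vector transfers the condition to this fibre.\<close>
      have "G P (J P (F.V \<beta>)) (J P (F.V \<beta>)) = G P (F.V \<beta>) (F.V \<beta>)" for \<beta>
      proof -
        obtain X where X: "smooth_vector_field (cotangent_atlas A) X"
          "X P = coord_vec (cotangent_atlas A) (cotangent_chart A c) P (0, \<beta>)"
          by (rule vertical_vector_field[OF c P]) blast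
        have "F.V \<beta> = X P" unfolding F.V_def sum_frame_p[OF c P] X(2) by simp
        then show ?thesis
          using herm X(1) P(1) unfolding almost_hermitian_def UN_cotangent_atlas by simp
      qed
      from F.only_if[OF this dim] show ?thesis unfolding pr by simp
    qed
    define lam where "lam = (\<lambda>t. c1 t / a1 t)"
    \<comment> \<open>Chosen so that \<open>lam + 2t mu = (c1 + 2t d1) / (a1 + 2t b1)\<close>. Since
      \<open>(c1 + 2t d1) a1 - c1 (a1 + 2t b1) = 2t (a1 d1 - c1 b1)\<close>, subtracting
      \<open>lam\<close> leaves a factor \<open>2t\<close> that cancels, and the quotient stays
      smooth at \<open>t = 0\<close>.\<close>
    define mu where "mu = (\<lambda>t. (a1 t * d1 t - c1 t * b1 t) / (a1 t * (a1 t + 2 * t * b1 t)))"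
    have "smooth_on {0..} (\<lambda>t::real. 2 * t)"
      by (intro smooth_on_bounded_linear[OF S] bounded_linear_mult_right)
    then have den: "smooth_on {0..} (\<lambda>t. a1 t * (a1 t + 2 * t * b1 t))"
      by (intro smooth_on_mult[OF S smooth_ab(1)] smooth_on_add[OF S smooth_ab(1)]
          smooth_on_mult[OF S _ smooth_ab(3)])
    have "smooth_on {0..} lam"
      unfolding lam_def using pos_ab
      by (intro smooth_on_divide[OF S] smooth_ab smooth_cd) fastforce
    moreover have "smooth_on {0..} mu"
      unfolding mu_def using pos_ab
      by (intro smooth_on_divide[OF S _ den] smooth_on_diff[OF S] smooth_on_mult[OF S] smooth_ab smooth_cd)
        fastforce
    moreover have "lam t > 0 \<and> lam t + 2 * t * mu t > 0 \<and> c1 t = lam t * a1 t \<and> c2 t = lam t * a2 t \<and>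
        c1 t + 2 * t * d1 t = (lam t + 2 * t * mu t) * (a1 t + 2 * t * b1 t) \<and>
        c2 t + 2 * t * d2 t = (lam t + 2 * t * mu t) * (a2 t + 2 * t * b2 t)" if t: "t \<ge> 0" for t
    proof -
      let ?a = "a1 t + 2 * t * b1 t" and ?b = "a2 t + 2 * t * b2 t" and ?c = "c1 t + 2 * t * d1 t"
      have pos: "a1 t > 0" "?a > 0" "c1 t > 0" "?c > 0" using pos_ab[OF t] pos_cd[OF t] by auto
      have lm: "lam t + 2 * t * mu t = ?c / ?a"
        using pos by (simp add: lam_def mu_def divide_simps) (simp add: algebra_simps)
      have "c2 t = lam t * a2 t"
      proof -
        \<comment> \<open>Inserting the factor \<open>a1 a2 = 1\<close> produces the square that
          occurs in \<open>rel\<close>; the radial equation below is treated alike.\<close>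
        have "lam t * a2 t = c1 t / a1 t * a2 t * (a1 t * a2 t)" using a1a2[OF t] by (simp add: lam_def)
        also have "\<dots> = c1 t * (a2 t)\<^sup>2" using pos(1) by (simp add: power2_eq_square)
        finally show ?thesis using rel[OF t] by simp
      qed
      moreover have "c2 t + 2 * t * d2 t = (?c / ?a) * ?b"
      proof -
        have "(?c / ?a) * ?b = ?c / ?a * ?b * (?a * ?b)" using ab[OF t] by simp
        also have "\<dots> = ?c * ?b\<^sup>2" using pos(2) by (simp add: power2_eq_square)
        finally show ?thesis using rel[OF t] by simp
      qed
      ultimately show ?thesis
        unfolding lm using pos by (simp add: lam_def)
    qed
    ultimately show ?conformal by blast
  next
    assume ?conformal
    then obtain lam mu where lm: "\<And>t. t \<ge> 0 \<Longrightarrow> c1 t = lam t * a1 t \<and> c2 t = lam t * a2 t \<and>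
        c1 t + 2 * t * d1 t = (lam t + 2 * t * mu t) * (a1 t + 2 * t * b1 t) \<and>
        c2 t + 2 * t * d2 t = (lam t + 2 * t * mu t) * (a2 t + 2 * t * b2 t)"
      by blast
    show ?herm
      unfolding almost_hermitian_def UN_cotangent_atlas
    proof (intro allI impI ballI)
      fix X Y P
      assume X: "smooth_vector_field (cotangent_atlas A) X" and Y: "smooth_vector_field (cotangent_atlas A) Y"
        and P: "P \<in> cotangent_bundle A"
      obtain c where c: "c \<in> A" "fst P \<in> fst c"
        using P by (auto simp: cotangent_bundle_def)
      define t where "t = energy A g c P"
      interpret F: diagonal_fibre "tangent_space (cotangent_atlas A) P" "frame_delta A g c P"
        "frame_p A c P" "J P" "G P" "metric_matrix A g c (fst P)"
        "matrix_inv (metric_matrix A g c (fst P))" "momentum A c P"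
        "\<chi> i. raised_momentum A g c P i" "a1 t" "a2 t" "b1 t" "b2 t" "c1 t" "c2 t" "d1 t" "d2 t"
        by (rule diagonal_fibre_adapted_frame[OF c(1) P c(2) g J G t_def])
      have pr: "momentum A c P \<bullet> (\<chi> i. raised_momentum A g c P i) = 2 * t"
        using energy_eq[OF c(1) P c(2), of g] raised_momentum_eq[OF c(1) P c(2) g] by (simp add: t_def)
      \<comment> \<open>\<open>2t\<close> is the squared length of the momentum, so the hypotheses
        stated for nonnegative arguments apply.\<close>
      have t: "t \<ge> 0" using F.norm_p_pos pr by (cases "momentum A c P = 0") auto
      have mem: "X P \<in> tangent_space (cotangent_atlas A) P" "Y P \<in> tangent_space (cotangent_atlas A) P"
        using X Y P unfolding smooth_vector_field_def UN_cotangent_atlas by auto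
      \<comment> \<open>Used for the pairs \<open>a1, a2\<close> and
        \<open>a1 + 2t b1, a2 + 2t b2\<close>, whose products are one, with \<open>l\<close> equal
        to \<open>lam\<close> and \<open>lam + 2t mu\<close>. This yields the four equations that
        \<open>hermitian_if\<close> asks for.\<close>
      have inverse_square: "l * x * y\<^sup>2 = l * y" "l * y * x\<^sup>2 = l * x"
        if "x * y = 1" for l x y :: real
      proof -
        have "l * x * y\<^sup>2 = l * y * (x * y)" "l * y * x\<^sup>2 = l * x * (x * y)"
          by (simp_all add: power2_eq_square)
        then show "l * x * y\<^sup>2 = l * y" "l * y * x\<^sup>2 = l * x" using that by simp_all
      qed
      from lm[OF t] have c12: "c1 t = lam t * a1 t" "c2 t = lam t * a2 t"
        and cd12: "c1 t + 2 * t * d1 t = (lam t + 2 * t * mu t) * (a1 t + 2 * t * b1 t)"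
          "c2 t + 2 * t * d2 t = (lam t + 2 * t * mu t) * (a2 t + 2 * t * b2 t)"
        by blast+
      have "c1 t * (a2 t)\<^sup>2 = c2 t" "c2 t * (a1 t)\<^sup>2 = c1 t"
        unfolding c12 by (rule inverse_square[OF a1a2[OF t]])+
      moreover have "(c1 t + 2 * t * d1 t) * (a2 t + 2 * t * b2 t)\<^sup>2 = c2 t + 2 * t * d2 t"
        "(c2 t + 2 * t * d2 t) * (a1 t + 2 * t * b1 t)\<^sup>2 = c1 t + 2 * t * d1 t"
        unfolding cd12 by (rule inverse_square[OF ab[OF t]])+
      ultimately show "G P (J P (X P)) (J P (Y P)) = G P (X P) (Y P)"
        using F.hermitian_if[OF _ _ _ _ mem] pr by metis
    qed
  qed
qed

end
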